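(* Let $K$ be a field, let $n_1<n_2<n_3<n_4$ be positive integers with $\gcd(n_1,n_2,n_3,n_4)=1$, and let $C$ be the monomial curve $x_i=t^{n_i}$ ($1\le i\le 4$) in $\mathbb{A}^4(K)$. Assume that $C$ is Gorenstein and not a complete intersection, that $C$ has Cohen-Macaulay tangent cone at the origin, and that $I(C)$ is minimally generated by $$f_1=x_1^{a_1}-x_3^{a_{13}}x_4^{a_{14}},\quad f_2=x_2^{a_2}-x_1^{a_{21}}x_3^{a_{23}},\quad f_3=x_3^{a_3}-x_2^{a_{32}}x_4^{a_{34}},$$ $$f_4=x_4^{a_4}-x_1^{a_{41}}x_2^{a_{42}},\quad f_5=x_1^{a_{21}}x_4^{a_{34}}-x_2^{a_{42}}x_3^{a_{13}},$$ where $a_i>1$ and $0<a_{ij}<a_j$ for all the exponents appearing. Suppose that $a_3>a_{32}+a_{34}$ and $a_{42}\le a_{32}$. Let $p_2=x_2^{a_2}$ if $a_2<a_{21}+a_{23}$ and $p_2=x_2^{a_2}-x_1^{a_{21}}x_3^{a_{23}}$ if $a_2=a_{21}+a_{23}$; and let $p_5=x_2^{a_{42}}x_3^{a_{13}}$ if $a_{42}+a_{13}<a_{21}+a_{34}$ and $p_5=x_1^{a_{21}}x_4^{a_{34}}-x_2^{a_{42}}x_3^{a_{13}}$ if $a_{42}+a_{13}=a_{21}+a_{34}$. (i) Suppose $a_{34}<a_{14}$. If $a_2\le a_{21}+a_{23}$, $a_{42}+a_{13}\le a_{21}+a_{34}$ and $a_3+a_{13}\le a_{21}+a_{32}-a_{42}+2a_{34}$,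 then $I(C)_*$ is minimally generated by the six polynomials $$G_*=\{x_3^{a_{13}}x_4^{a_{14}},\ p_2,\ x_2^{a_{32}}x_4^{a_{34}},\ x_4^{a_4},\ p_5,\ p_6\},$$ where $p_6=x_3^{a_3+a_{13}}$ if $a_3+a_{13}<a_{21}+a_{32}-a_{42}+2a_{34}$ and $p_6=x_3^{a_3+a_{13}}-x_1^{a_{21}}x_2^{a_{32}-a_{42}}x_4^{2a_{34}}$ if $a_3+a_{13}=a_{21}+a_{32}-a_{42}+2a_{34}$. (ii) Suppose $a_{14}\le a_{34}$. If $a_2\le a_{21}+a_{23}$, $a_{42}+a_{13}\le a_{21}+a_{34}$ and $a_3+a_{13}\le a_1+a_{32}+a_{34}-a_{14}$, then $I(C)_*$ is minimally generated by the six polynomials $$G_*=\{x_3^{a_{13}}x_4^{a_{14}},\ p_2,\ x_2^{a_{32}}x_4^{a_{34}},\ x_4^{a_4},\ p_5,\ p_6\},$$ where $p_6=x_3^{a_3+a_{13}}$ if $a_3+a_{13}<a_1+a_{32}+a_{34}-a_{14}$ and $p_6=x_3^{a_3+a_{13}}-x_1^{a_1}x_2^{a_{32}}x_4^{a_{34}-a_{14}}$ if $a_3+a_{13}=a_1+a_{32}+a_{34}-a_{14}$.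
   Context: $I(C)$ is the kernel of the $K$-algebra homomorphism $\phi:K[x_1,\ldots,x_4]\to K[t]$, $\phi(x_i)=t^{n_i}$. $C$ is Gorenstein when the numerical semigroup generated by $n_1,\ldots,n_4$ is symmetric, and it is not a complete intersection when $I(C)$ cannot be generated by three elements. For $0\ne f\in I(C)$, $f_*$ denotes the homogeneous summand of $f$ of least (standard) degree, and $I(C)_*$ is the ideal of $K[x_1,\ldots,x_4]$ generated by all $f_*$, $f\in I(C)$; it is the defining ideal of the tangent cone of $C$ at the origin. $C$ has Cohen-Macaulay tangent cone at the origin if $K[x_1,\ldots,x_4]/I(C)_*$ is Cohen-Macaulay. In the described situation the exponents satisfy (Bresinsky) $a_1=a_{21}+a_{41}$, $a_2=a_{32}+a_{42}$, $a_3=a_{13}+a_{23}$, $a_4=a_{14}+a_{34}$. *)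

theory Defs
  imports
    "HOL-Library.Poly_Mapping"
    "HOL-Library.Product_Plus"
    "HOL-Library.Extended_Nat"
    "HOL-Computational_Algebra.Polynomial"
    "HOL-Algebra.Ring_Divisibility"
    "HOL-Algebra.Algebraic_Closure_Type"
begin

section \<open>The polynomial ring in four variables\<close>

text \<open>
  The ring \<open>K[x\<^sub>1,x\<^sub>2,x\<^sub>3,x\<^sub>4]\<close> is the monoid algebra of the additive monoid of exponent
  vectors: the coefficient of \<open>x\<^sub>1\<^sup>a x\<^sub>2\<^sup>b x\<^sub>3\<^sup>c x\<^sub>4\<^sup>d\<close> in \<open>f\<close> is \<open>lookup f (a,b,c,d)\<close>.
\<close>

type_synonym expo = "nat \<times> nat \<times> nat \<times> nat"
type_synonym 'k poly4 = "expo \<Rightarrow>\<^sub>0 'k"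

definition X\<^sub>1 :: "'k::field poly4" where "X\<^sub>1 = Poly_Mapping.single (1,0,0,0) 1"
definition X\<^sub>2 :: "'k::field poly4" where "X\<^sub>2 = Poly_Mapping.single (0,1,0,0) 1"
definition X\<^sub>3 :: "'k::field poly4" where "X\<^sub>3 = Poly_Mapping.single (0,0,1,0) 1"
definition X\<^sub>4 :: "'k::field poly4" where "X\<^sub>4 = Poly_Mapping.single (0,0,0,1) 1"

abbreviation poly4_ring :: "'k::field poly4 ring"
  where "poly4_ring \<equiv> ring_of_type_algebra"

text \<open>Minimality is irredundancy. For generators that are homogeneous (for the standard grading,
  or for the grading with \<open>deg x\<^sub>i = n\<^sub>i > 0\<close>), this is the same as having the least possible
  number of generators.\<close>

definition minimally_generated_by :: "('a, 'b) ring_scheme \<Rightarrow> 'a set \<Rightarrow> 'a list \<Rightarrow> bool" where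
  "minimally_generated_by R I gs \<longleftrightarrow>
     set gs \<subseteq> carrier R \<and> distinct gs \<and>
     I = Idl\<^bsub>R\<^esub> (set gs) \<and> (\<forall>A. A \<subset> set gs \<longrightarrow> I \<noteq> Idl\<^bsub>R\<^esub> A)"

section \<open>Initial forms\<close>

definition total_degree :: "expo \<Rightarrow> nat" where
  "total_degree = (\<lambda>(a,b,c,d). a + b + c + d)"

definition homogeneous_summand :: "nat \<Rightarrow> 'k::field poly4 \<Rightarrow> 'k poly4" where
  "homogeneous_summand k f =
     (\<Sum>m | m \<in> Poly_Mapping.keys f \<and> total_degree m = k. Poly_Mapping.single m (Poly_Mapping.lookup f m))"

definition initial_form :: "'k::field poly4 \<Rightarrow> 'k poly4" where
  "initial_form f = homogeneous_summand (Min (total_degree ` Poly_Mapping.keys f)) f"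

definition initial_ideal :: "'k::field poly4 set \<Rightarrow> 'k poly4 set" where
  "initial_ideal I = Idl\<^bsub>poly4_ring\<^esub> {initial_form f | f. f \<in> I \<and> f \<noteq> 0}"

section \<open>Monomial curves in affine 4-space\<close>

definition curve_hom :: "nat \<Rightarrow> nat \<Rightarrow> nat \<Rightarrow> nat \<Rightarrow> 'k::field poly4 \<Rightarrow> 'k poly" where
  "curve_hom n\<^sub>1 n\<^sub>2 n\<^sub>3 n\<^sub>4 f =
     (let t = [:0, 1:] in
      \<Sum>(a,b,c,d) \<in> Poly_Mapping.keys f.
        smult (Poly_Mapping.lookup f (a,b,c,d)) ((t^n\<^sub>1)^a * (t^n\<^sub>2)^b * (t^n\<^sub>3)^c * (t^n\<^sub>4)^d))"

definition curve_ideal :: "nat \<Rightarrow> nat \<Rightarrow> nat \<Rightarrow> nat \<Rightarrow> 'k::field poly4 set" where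
  "curve_ideal n\<^sub>1 n\<^sub>2 n\<^sub>3 n\<^sub>4 = {f. curve_hom n\<^sub>1 n\<^sub>2 n\<^sub>3 n\<^sub>4 f = 0}"

definition generated_semigroup :: "nat \<Rightarrow> nat \<Rightarrow> nat \<Rightarrow> nat \<Rightarrow> nat set" where
  "generated_semigroup n\<^sub>1 n\<^sub>2 n\<^sub>3 n\<^sub>4 = {a * n\<^sub>1 + b * n\<^sub>2 + c * n\<^sub>3 + d * n\<^sub>4 | a b c d. True}"

text \<open>The Frobenius number is the largest integer outside the semigroup, hence \<open>-1\<close> for the
  semigroup of all natural numbers. It is meaningful only for cofinite semigroups.\<close>

definition frobenius_number :: "nat set \<Rightarrow> int" where
  "frobenius_number S = (GREATEST z. z \<notin> int ` S)"

definition symmetric_semigroup :: "nat set \<Rightarrow> bool" where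
  "symmetric_semigroup S \<longleftrightarrow>
     (\<forall>z::int. z \<in> int ` S \<longleftrightarrow> frobenius_number S - z \<notin> int ` S)"

definition gorenstein_curve :: "nat \<Rightarrow> nat \<Rightarrow> nat \<Rightarrow> nat \<Rightarrow> bool" where
  "gorenstein_curve n\<^sub>1 n\<^sub>2 n\<^sub>3 n\<^sub>4 \<longleftrightarrow> symmetric_semigroup (generated_semigroup n\<^sub>1 n\<^sub>2 n\<^sub>3 n\<^sub>4)"

text \<open>The curve has codimension 3 in affine 4-space.\<close>

definition complete_intersection_ideal :: "'k::field poly4 set \<Rightarrow> bool" where
  "complete_intersection_ideal I \<longleftrightarrow> (\<exists>f g h. I = Idl\<^bsub>poly4_ring\<^esub> {f, g, h})"

section \<open>Cohen--Macaulay rings\<close>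

definition fraction_rel :: "('a, 'b) ring_scheme \<Rightarrow> 'a set \<Rightarrow> (('a \<times> 'a) \<times> ('a \<times> 'a)) set" where
  "fraction_rel R S =
     {((r, s), (r', s')). r \<in> carrier R \<and> s \<in> S \<and> r' \<in> carrier R \<and> s' \<in> S \<and>
        (\<exists>u\<in>S. u \<otimes>\<^bsub>R\<^esub> (s' \<otimes>\<^bsub>R\<^esub> r) = u \<otimes>\<^bsub>R\<^esub> (s \<otimes>\<^bsub>R\<^esub> r'))}"

text \<open>The ring of fractions \<open>S\<inverse>R\<close> for a multiplicatively closed set \<open>S\<close>; the fraction \<open>r/s\<close> is
  the equivalence class of \<open>(r, s)\<close>. In the sum and the product all classes in the union
  coincide.\<close>

definition fraction_ring :: "('a, 'b) ring_scheme \<Rightarrow> 'a set \<Rightarrow> ('a \<times> 'a) set ring" where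
  "fraction_ring R S = (let rel = fraction_rel R S in
     \<lparr> carrier = (carrier R \<times> S) // rel,
       monoid.mult = (\<lambda>p q. \<Union>(r, s) \<in> p. \<Union>(r', s') \<in> q. rel `` {(r \<otimes>\<^bsub>R\<^esub> r', s \<otimes>\<^bsub>R\<^esub> s')}),
       one = rel `` {(\<one>\<^bsub>R\<^esub>, \<one>\<^bsub>R\<^esub>)},
       ring.zero = rel `` {(\<zero>\<^bsub>R\<^esub>, \<one>\<^bsub>R\<^esub>)},
       add = (\<lambda>p q. \<Union>(r, s) \<in> p. \<Union>(r', s') \<in> q.
                rel `` {((s' \<otimes>\<^bsub>R\<^esub> r) \<oplus>\<^bsub>R\<^esub> (s \<otimes>\<^bsub>R\<^esub> r'), s \<otimes>\<^bsub>R\<^esub> s')}) \<rparr>)"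

definition localization_at :: "('a, 'b) ring_scheme \<Rightarrow> 'a set \<Rightarrow> ('a \<times> 'a) set ring" where
  "localization_at R P = fraction_ring R (carrier R - P)"

definition krull_dim :: "('a, 'b) ring_scheme \<Rightarrow> enat" where
  "krull_dim R = Sup {enat k | k. \<exists>P :: nat \<Rightarrow> 'a set.
     (\<forall>i\<le>k. primeideal (P i) R) \<and> (\<forall>i<k. P i \<subset> P (Suc i))}"

definition regular_sequence :: "('a, 'b) ring_scheme \<Rightarrow> 'a list \<Rightarrow> bool" where
  "regular_sequence R rs \<longleftrightarrow>
     set rs \<subseteq> carrier R \<and>
     (\<forall>i < length rs. \<forall>r \<in> carrier R.
        rs ! i \<otimes>\<^bsub>R\<^esub> r \<in> Idl\<^bsub>R\<^esub> (set (take i rs)) \<longrightarrow> r \<in> Idl\<^bsub>R\<^esub> (set (take i rs))) \<and>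
     Idl\<^bsub>R\<^esub> (set rs) \<noteq> carrier R"

definition grade :: "('a, 'b) ring_scheme \<Rightarrow> 'a set \<Rightarrow> enat" where
  "grade R I = Sup {enat (length rs) | rs. regular_sequence R rs \<and> set rs \<subseteq> I}"

text \<open>The depth of a local ring is the grade of its maximal ideal.\<close>

definition cohen_macaulay_local :: "('a, 'b) ring_scheme \<Rightarrow> bool" where
  "cohen_macaulay_local R \<longleftrightarrow>
     cring R \<and> noetherian_ring R \<and>
     (\<exists>M. maximalideal M R \<and> (\<forall>N. maximalideal N R \<longrightarrow> N = M) \<and> grade R M = krull_dim R)"

definition cohen_macaulay :: "('a, 'b) ring_scheme \<Rightarrow> bool" where
  "cohen_macaulay R \<longleftrightarrow>
     cring R \<and> noetherian_ring R \<and>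
     (\<forall>M. maximalideal M R \<longrightarrow> cohen_macaulay_local (localization_at R M))"

definition cohen_macaulay_tangent_cone :: "'k::field poly4 set \<Rightarrow> bool" where
  "cohen_macaulay_tangent_cone I \<longleftrightarrow> cohen_macaulay (poly4_ring Quot (initial_ideal I))"

end

theory Submission
  imports Defs
begin

text \<open>
  Orient every generator of \<open>I\<close>, together with the sixth binomial
  \<open>f\<^sub>6 = x\<^sub>3\<^bsup>a\<^sub>3+a\<^sub>1\<^sub>3\<^esup> - q\<close>, as a rewriting rule on monomials from its term of least degree (in case of
  equal degrees: its term without \<open>x\<^sub>1\<close>) to the other term. A rule never lowers the degree and
  strictly raises the degree plus the exponent of \<open>x\<^sub>1\<close>, so rewriting terminates, since it stays
  inside the finite set of monomials with a fixed \<open>t\<close>-degree. All critical pairs are joinable, so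
  normal forms are unique. An element \<open>f\<close> of \<open>I\<close> is killed by every linear functional that is
  constant on rewriting classes. Modulo the six proposed initial forms, a monomial of \<open>f\<^sub>*\<close> is congruent
  to \<open>0\<close> if its normal form has larger degree, and to its normal form otherwise. The monomials of \<open>f\<close>
  with a normal form of degree \<open>deg f\<^sub>*\<close> all lie in \<open>f\<^sub>*\<close>, hence the remaining coefficients cancel and
  \<open>f\<^sub>*\<close> is in the ideal. The relations between the exponents follow from the fact that a monomial
  not divisible by a term of a generator occurs in no element of \<open>I\<close>. Minimality
  holds because the six leading monomials form an antichain under divisibility.
\<close>

section \<open>Ideals of the polynomial ring\<close>

lemma carrier_ring_of_type_algebra [simp]: "carrier ring_of_type_algebra = UNIV"
  by (simp add: ring_of_type_algebra_def)

text \<open>Negation is multiplication by \<open>- 1\<close>, and commutativity turns left multiples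
  into right ones, so these three closure properties already give an ideal.\<close>

lemma ideal_ring_of_type_algebraI:
  fixes J :: "'a::comm_ring_1 set"
  assumes "0 \<in> J" and "\<And>x y. x \<in> J \<Longrightarrow> y \<in> J \<Longrightarrow> x + y \<in> J" and "\<And>r x. x \<in> J \<Longrightarrow> r * x \<in> J"
  shows "ideal J ring_of_type_algebra"
proof -
  let ?R = "ring_of_type_algebra :: 'a ring"
  interpret cring ?R
    by (rule cring_from_type_algebra)
  have "\<ominus>\<^bsub>?R\<^esub> x = - x" for x
    by (rule minus_equality) (simp_all add: ring_of_type_algebra_def)
  then have "subgroup J (add_monoid ?R)"
    using assms(3)[of _ "- 1"]
    by (intro add.subgroupI) (use assms(1) in \<open>auto simp: ring_of_type_algebra_def a_inv_def assms(2)\<close>)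
  then show ?thesis
    using assms(3)
    by (intro idealI ring_axioms) (auto simp: ring_of_type_algebra_def mult.commute)
qed

lemma ideal_ring_of_type_algebraD:
  fixes J :: "'a::comm_ring_1 set"
  assumes "ideal J ring_of_type_algebra"
  shows "0 \<in> J" and "x \<in> J \<Longrightarrow> y \<in> J \<Longrightarrow> x + y \<in> J" and "x \<in> J \<Longrightarrow> r * x \<in> J"
proof -
  interpret ideal J "ring_of_type_algebra :: 'a ring"
    by (fact assms)
  show "0 \<in> J"
    using additive_subgroup.zero_closed[OF ideal.axioms(1)[OF assms]] by (simp add: ring_of_type_algebra_def)
  show "x \<in> J \<Longrightarrow> y \<in> J \<Longrightarrow> x + y \<in> J"
    using additive_subgroup.a_closed[OF ideal.axioms(1)[OF assms], of x y] by (simp add: ring_of_type_algebra_def)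
  show "x \<in> J \<Longrightarrow> r * x \<in> J"
    using I_l_closed[of x r] by (simp add: ring_of_type_algebra_def)
qed

lemma genideal_ring_of_type_algebra:
  fixes S :: "'a::comm_ring_1 set"
  shows "ideal (Idl\<^bsub>ring_of_type_algebra\<^esub> S) ring_of_type_algebra"
    and "S \<subseteq> Idl\<^bsub>ring_of_type_algebra\<^esub> S"
    and "ideal J ring_of_type_algebra \<Longrightarrow> S \<subseteq> J \<Longrightarrow> Idl\<^bsub>ring_of_type_algebra\<^esub> S \<subseteq> J"
proof -
  interpret cring "ring_of_type_algebra :: 'a ring"
    by (rule cring_from_type_algebra)
  show "ideal (Idl\<^bsub>ring_of_type_algebra\<^esub> S) ring_of_type_algebra"
    by (rule genideal_ideal) simp
  show "S \<subseteq> Idl\<^bsub>ring_of_type_algebra\<^esub> S"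
    by (rule genideal_self) simp
  show "Idl\<^bsub>ring_of_type_algebra\<^esub> S \<subseteq> J" if "ideal J ring_of_type_algebra" "S \<subseteq> J"
    using that by (rule genideal_minimal)
qed

lemma ideal_sum:
  fixes J :: "'a::comm_ring_1 set"
  assumes "ideal J ring_of_type_algebra" "\<And>i. i \<in> A \<Longrightarrow> f i \<in> J"
  shows "sum f A \<in> J"
  using assms(2)
  by (induction A rule: infinite_finite_induct) (auto intro: ideal_ring_of_type_algebraD[OF assms(1)])

section \<open>Linear functionals on a monoid algebra\<close>

abbreviation monomial :: "'a \<Rightarrow> 'a \<Rightarrow>\<^sub>0 'k::{zero_neq_one}"
  where "monomial m \<equiv> Poly_Mapping.single m 1"

text \<open>The linear functional on the monoid algebra that takes the value \<open>\<phi> m\<close>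
  on the monomial with exponent \<open>m\<close>.\<close>

definition pairing :: "('a \<Rightarrow> 'k::comm_ring_1) \<Rightarrow> ('a \<Rightarrow>\<^sub>0 'k) \<Rightarrow> 'k" where
  "pairing \<phi> f = (\<Sum>m\<in>Poly_Mapping.keys f. Poly_Mapping.lookup f m * \<phi> m)"

lemma pairing_superset:
  assumes "finite A" "Poly_Mapping.keys f \<subseteq> A"
  shows "pairing \<phi> f = (\<Sum>m\<in>A. Poly_Mapping.lookup f m * \<phi> m)"
  unfolding pairing_def using assms
  by (intro sum.mono_neutral_left) (auto simp: in_keys_iff)

lemma pairing_zero [simp]: "pairing \<phi> 0 = 0"
  by (simp add: pairing_def)

lemma pairing_add: "pairing \<phi> (f + g) = pairing \<phi> f + pairing \<phi> g"
  using keys_add[of f g]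
  by (simp add: pairing_superset[where A = "Poly_Mapping.keys f \<union> Poly_Mapping.keys g"]
      lookup_add ring_distribs sum.distrib)

lemma pairing_diff: "pairing \<phi> (f - g) = pairing \<phi> f - pairing \<phi> g"
  using pairing_add[of \<phi> "f - g" g] by simp

lemma pairing_single [simp]: "pairing \<phi> (Poly_Mapping.single m c) = c * \<phi> m"
  by (simp add: pairing_superset[where A = "{m}"])

lemma pairing_sum: "pairing \<phi> (\<Sum>i\<in>A. f i) = (\<Sum>i\<in>A. pairing \<phi> (f i))"
  by (induction A rule: infinite_finite_induct) (simp_all add: pairing_add)

lemma sum_singles_eq: "(\<Sum>m\<in>Poly_Mapping.keys f. Poly_Mapping.single m (Poly_Mapping.lookup f m)) = f"
  by (rule poly_mapping_eqI)
    (simp add: lookup_sum lookup_single when_def in_keys_iff)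

text \<open>Multiplication by \<open>h\<close> turns a functional into a combination of its shifts.
  Hence the common kernel of a shift-closed set of functionals is an ideal.\<close>

lemma pairing_mult:
  fixes f h :: "'a::comm_monoid_add \<Rightarrow>\<^sub>0 'k::comm_ring_1"
  shows "pairing \<phi> (h * f) = (\<Sum>w\<in>Poly_Mapping.keys h. Poly_Mapping.lookup h w * pairing (\<lambda>m. \<phi> (w + m)) f)"
proof -
  have "pairing \<phi> (h * f) = pairing \<phi> ((\<Sum>w\<in>Poly_Mapping.keys h. Poly_Mapping.single w (Poly_Mapping.lookup h w)) *
                (\<Sum>m\<in>Poly_Mapping.keys f. Poly_Mapping.single m (Poly_Mapping.lookup f m)))"
    by (simp only: sum_singles_eq)
  also have "\<dots> = (\<Sum>w\<in>Poly_Mapping.keys h. \<Sum>m\<in>Poly_Mapping.keys f.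
      Poly_Mapping.lookup h w * Poly_Mapping.lookup f m * \<phi> (w + m))"
    by (simp only: sum_product pairing_sum mult_single pairing_single)
  finally show ?thesis
    by (simp add: pairing_def sum_distrib_left mult.assoc)
qed

section \<open>Normal forms\<close>

text \<open>One rewriting step: multiplication of monomials is addition of exponents, so a rule
  applies inside every multiple of its left side.\<close>

definition translates :: "('a \<times> 'a) set \<Rightarrow> ('a::plus \<times> 'a) set" where
  "translates R = {(l + w, r + w) | l r w. (l, r) \<in> R}"

lemma translatesI: "(l, r) \<in> R \<Longrightarrow> u = l + w \<Longrightarrow> v = r + w \<Longrightarrow> (u, v) \<in> translates R"
  by (auto simp: translates_def)

lemma translatesE:
  assumes "(u, v) \<in> translates R"
  obtains l r w where "(l, r) \<in> R" "u = l + w" "v = r + w"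
  using assms by (auto simp: translates_def)

lemma translates_add:
  fixes u :: "'a::semigroup_add"
  shows "(u, v) \<in> translates R \<Longrightarrow> (u + w, v + w) \<in> translates R"
  by (auto simp: translates_def) (metis add.assoc)

lemma rtrancl_translates_add:
  fixes u :: "'a::semigroup_add"
  assumes "(u, v) \<in> (translates R)\<^sup>*"
  shows "(u + w, v + w) \<in> (translates R)\<^sup>*"
  using assms by induction (auto intro: translates_add rtrancl_into_rtrancl)

definition joinable :: "('a \<times> 'a) set \<Rightarrow> 'a \<Rightarrow> 'a \<Rightarrow> bool" where
  "joinable S u v \<longleftrightarrow> (\<exists>z. (u, z) \<in> S\<^sup>* \<and> (v, z) \<in> S\<^sup>*)"

lemma joinableI: "(u, z) \<in> S\<^sup>* \<Longrightarrow> (v, z) \<in> S\<^sup>* \<Longrightarrow> joinable S u v"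
  by (auto simp: joinable_def)

lemma joinable_sym: "joinable S u v \<Longrightarrow> joinable S v u"
  by (auto simp: joinable_def)

lemma joinable_translates_add:
  fixes u :: "'a::semigroup_add"
  shows "joinable (translates R) u v \<Longrightarrow> joinable (translates R) (u + w) (v + w)"
  unfolding joinable_def by (blast intro: rtrancl_translates_add)

lemma ex_normal_form:
  assumes "wf (S\<inverse>)"
  shows "\<exists>v. (u, v) \<in> S\<^sup>* \<and> v \<notin> Domain S"
  using assms
proof (induction u rule: wf_induct_rule)
  case (less u)
  then show ?case
    by (cases "u \<in> Domain S") (blast intro: converse_rtrancl_into_rtrancl)+
qed

text \<open>Newman's lemma, with confluence stated as uniqueness of the normal form.\<close>

lemma ex1_normal_form:
  assumes "wf (S\<inverse>)" and confl: "\<And>u v v'. (u, v) \<in> S \<Longrightarrow> (u, v') \<in> S \<Longrightarrow> joinable S v v'"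
  shows "\<exists>!v. (u, v) \<in> S\<^sup>* \<and> v \<notin> Domain S"
  using assms(1)
proof (induction u rule: wf_induct_rule)
  case (less u)
  show ?case
  proof (cases "u \<in> Domain S")
    case False
    then show ?thesis
      by (metis Domain.DomainI converse_rtranclE rtrancl.rtrancl_refl)
  next
    case True
    then obtain u1 where u1: "(u, u1) \<in> S" by blast
    then obtain v where v: "(u1, v) \<in> S\<^sup>*" "v \<notin> Domain S"
      using less by blast
    have "x = v" if x: "(u, x) \<in> S\<^sup>*" "x \<notin> Domain S" for x
    proof -
      obtain u2 where u2: "(u, u2) \<in> S" "(u2, x) \<in> S\<^sup>*"
        using x True by (metis converse_rtranclE)
      obtain z where z: "(u1, z) \<in> S\<^sup>*" "(u2, z) \<in> S\<^sup>*"
        using confl[OF u1 u2(1)] by (auto simp: joinable_def)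
      \<comment> \<open>A normal form of the common reduct \<open>z\<close> is one of
        \<open>u1\<close> and of \<open>u2\<close>, so the induction hypothesis identifies both
        \<open>v\<close> and \<open>x\<close> with it.\<close>
      obtain y where y: "(z, y) \<in> S\<^sup>*" "y \<notin> Domain S"
        using ex_normal_form[OF assms(1)] by blast
      have "(u1, y) \<in> S\<^sup>*" "(u2, y) \<in> S\<^sup>*"
        using z y by auto
      then have "v = y" "x = y"
        using less[of u1] less[of u2] u1 u2 v x(2) y(2) by (auto 0 3)
      then show ?thesis by simp
    qed
    moreover have "(u, v) \<in> S\<^sup>*"
      using u1 v(1) by (rule converse_rtrancl_into_rtrancl)
    ultimately show ?thesis
      using v(2) by blast
  qed
qed

text \<open>A functional constant on rewriting classes kills each binomial \<open>u - v\<close> of a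
  rule, whichever way round it is written, and all multiples of it.\<close>

lemma pairing_genideal_binomials:
  fixes F :: "('a::comm_monoid_add \<Rightarrow>\<^sub>0 'k::comm_ring_1) set"
  assumes F: "\<And>g. g \<in> F \<Longrightarrow> \<exists>u v. (u, v) \<in> R \<union> R\<inverse> \<and> g = monomial u - monomial v"
    and f: "f \<in> Idl\<^bsub>ring_of_type_algebra\<^esub> F"
    and \<phi>: "\<And>u v. (u, v) \<in> translates R \<Longrightarrow> \<phi> u = \<phi> v"
  shows "pairing \<phi> f = 0"
proof -
  \<comment> \<open>The kernel of \<open>\<phi>\<close> alone need not be an ideal, since
    multiplication shifts the functional; all class-constant functionals together are closed under
    shifts.\<close>
  define invs where "invs = {\<psi>. \<forall>u v. (u, v) \<in> translates R \<longrightarrow> \<psi> u = (\<psi> v :: 'k)}"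
  let ?K = "{f. \<forall>\<psi>\<in>invs. pairing \<psi> f = 0}"
  have shift: "(\<lambda>m. \<psi> (w + m)) \<in> invs" if "\<psi> \<in> invs" for \<psi> w
    using that translates_add[of _ _ R w] by (auto simp: invs_def add.commute[of w])
  have "ideal ?K ring_of_type_algebra"
    by (rule ideal_ring_of_type_algebraI) (simp_all add: pairing_add pairing_mult shift)
  moreover have "F \<subseteq> ?K"
  proof
    fix g assume "g \<in> F"
    then obtain u v where "(u, v) \<in> R \<union> R\<inverse>" "g = monomial u - monomial v"
      using F by blast
    moreover have "R \<subseteq> translates R"
      by (auto intro: translatesI[where w = 0])
    ultimately show "g \<in> ?K"
      by (auto simp: invs_def pairing_diff)
  qed
  ultimately show ?thesis
    using genideal_ring_of_type_algebra(3)[of ?K F] f \<phi> by (auto simp: invs_def)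
qed

section \<open>Initial forms modulo an ideal\<close>

text \<open>For distinct \<open>l\<close> and \<open>r\<close>, \<open>\<delta> l r\<close> is the
  initial form of the binomial \<open>l - r\<close> when the degree does not drop. Modulo
  \<open>J\<close> a step of equal degree replaces the monomial by its target, and a step that
  raises the degree replaces it by 0.\<close>

lemma reduction_mod_ideal:
  fixes J :: "'k::field poly4 set"
  defines "\<delta> \<equiv> \<lambda>l r. monomial l - (if total_degree l = total_degree r then monomial r else 0)"
  assumes J: "ideal J poly4_ring"
    and R: "\<And>l r. (l, r) \<in> R \<Longrightarrow> total_degree l \<le> total_degree r \<and> \<delta> l r \<in> J"
    and uv: "(u, v) \<in> (translates R)\<^sup>*"
  shows "total_degree u \<le> total_degree v \<and> \<delta> u v \<in> J"
  using uv
proof induction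
  case base
  then show ?case
    using ideal_ring_of_type_algebraD(1)[OF J] by (simp add: \<delta>_def)
next
  case (step y z)
  obtain l r w where lr: "(l, r) \<in> R" "y = l + w" "z = r + w"
    using step.hyps(2) by (auto simp: translates_def)
  have td: "total_degree (a + b) = total_degree a + total_degree b" for a b
    by (cases a; cases b) (simp add: total_degree_def)
  have 1: "(monomial (a + w) :: 'k poly4) = monomial w * monomial a" for a :: expo
    by (simp add: mult_single add.commute)
  \<comment> \<open>Translation by \<open>w\<close> raises both degrees equally, so the same branch
    of \<open>\<delta>\<close> applies before and after it.\<close>
  have eq: "\<delta> y z = monomial w * \<delta> l r"
    using lr(2,3) by (simp add: \<delta>_def td 1 right_diff_distrib)
  have yz: "total_degree y \<le> total_degree z" "\<delta> y z \<in> J"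
    unfolding eq using R[OF lr(1)] ideal_ring_of_type_algebraD(3)[OF J] lr(2,3) by (auto simp: td)
  show ?case
  proof (cases "total_degree u = total_degree y")
    case True
    then have "\<delta> u z = \<delta> u y + \<delta> y z"
      by (simp add: \<delta>_def)
    then show ?thesis
      using step.IH yz ideal_ring_of_type_algebraD(2)[OF J] by auto
  next
    \<comment> \<open>The degree has already risen before the last step, so both sides are just the
      monomial \<open>u\<close>.\<close>
    case False
    then have "\<delta> u z = \<delta> u y"
      using step.IH yz by (auto simp: \<delta>_def)
    then show ?thesis
      using step.IH yz by auto
  qed
qed

text \<open>Modulo \<open>J\<close> the initial form becomes a combination of normal forms of the
  least degree \<open>d\<close>; the coefficient at each of them is the value on \<open>f\<close> of
  a class-constant functional, hence 0.\<close>

lemma initial_form_in_ideal: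
  fixes J :: "'k::field poly4 set" and R :: "(expo \<times> expo) set"
  defines "S \<equiv> translates R"
  assumes J: "ideal J poly4_ring"
    and wf: "wf (S\<inverse>)" and confl: "\<And>u v v'. (u, v) \<in> S \<Longrightarrow> (u, v') \<in> S \<Longrightarrow> joinable S v v'"
    and R: "\<And>l r. (l, r) \<in> R \<Longrightarrow> total_degree l \<le> total_degree r \<and>
               monomial l - (if total_degree l = total_degree r then monomial r else 0) \<in> J"
    and F: "\<And>g. g \<in> F \<Longrightarrow> \<exists>u v. (u, v) \<in> R \<union> R\<inverse> \<and> g = monomial u - monomial v"
    and f: "f \<in> Idl\<^bsub>poly4_ring\<^esub> F" "f \<noteq> 0"
  shows "initial_form f \<in> J"
proof -
  define nf where "nf u = (THE v. (u, v) \<in> S\<^sup>* \<and> v \<notin> Domain S)" for u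
  have nf: "(u, nf u) \<in> S\<^sup>* \<and> nf u \<notin> Domain S" for u
    unfolding nf_def by (rule theI') (rule ex1_normal_form[OF wf confl])
  have nf_eq: "nf u = nf v" if "(u, v) \<in> S" for u v
  proof -
    have "(u, nf v) \<in> S\<^sup>* \<and> nf v \<notin> Domain S"
      using nf[of v] that by (auto intro: converse_rtrancl_into_rtrancl)
    then show ?thesis
      unfolding nf_def[of u] by (intro the1_equality ex1_normal_form[OF wf confl])
  qed
  have kernel: "pairing \<phi> f = 0" if "\<And>u v. (u, v) \<in> S \<Longrightarrow> \<phi> u = \<phi> v" for \<phi>
    by (rule pairing_genideal_binomials[OF F f(1)]) (auto intro: that simp: S_def)
  let ?c = "Poly_Mapping.lookup f" and ?\<kappa> = "Poly_Mapping.keys f"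
  define d where "d = Min (total_degree ` ?\<kappa>)"
  define M where "M = {m \<in> ?\<kappa>. total_degree m = d}"
  have fin: "finite M"
    by (simp add: M_def)
  have red: "total_degree m \<le> total_degree (nf m) \<and>
      monomial m - (if total_degree m = total_degree (nf m) then monomial (nf m) else 0) \<in> J" for m
    using reduction_mod_ideal[OF J R, of R m "nf m"] nf[of m] unfolding S_def by simp
  \<comment> \<open>\<open>single 0 c\<close> is the constant polynomial \<open>c\<close>.\<close>
  have "(\<Sum>m\<in>M. Poly_Mapping.single 0 (?c m) *
      (monomial m - (if total_degree m = total_degree (nf m) then monomial (nf m) else 0))) \<in> J"
    using red by (intro ideal_sum[OF J] ideal_ring_of_type_algebraD(3)[OF J]) blast
  also have "(\<Sum>m\<in>M. Poly_Mapping.single 0 (?c m) *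
      (monomial m - (if total_degree m = total_degree (nf m) then monomial (nf m) else 0))) =
      (\<Sum>m\<in>M. Poly_Mapping.single m (?c m)) -
      (\<Sum>m\<in>M. if total_degree (nf m) = d then Poly_Mapping.single (nf m) (?c m) else 0)"
    unfolding sum_subtractf[symmetric]
    by (intro sum.cong) (auto simp: M_def right_diff_distrib mult_single)
  also have "(\<Sum>m\<in>M. if total_degree (nf m) = d then Poly_Mapping.single (nf m) (?c m) else 0) = 0"
  proof (rule poly_mapping_eqI)
    fix v
    have "Poly_Mapping.lookup (\<Sum>m\<in>M. if total_degree (nf m) = d then Poly_Mapping.single (nf m) (?c m) else 0) v
        = (\<Sum>m\<in>M. if nf m = v \<and> total_degree v = d then ?c m else 0)"
      unfolding lookup_sum by (intro sum.cong) (auto simp: lookup_single when_def)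
    also have "\<dots> = (if total_degree v = d then pairing (\<lambda>m. if nf m = v then 1 else 0) f else 0)"
    proof (cases "total_degree v = d")
      case True
      \<comment> \<open>Reduction never lowers the degree, so \<open>m\<close> has degree at most
        \<open>d\<close>, and at least \<open>d\<close> by minimality. The sum over \<open>M\<close>
        may thus be extended to all monomials of \<open>f\<close>.\<close>
      have inM: "m \<in> M" if "m \<in> ?\<kappa>" "nf m = v" for m
        using red[of m] that True by (auto simp: M_def d_def intro: antisym)
      have "(\<Sum>m\<in>M. if nf m = v \<and> total_degree v = d then ?c m else 0) =
          (\<Sum>m\<in>?\<kappa>. ?c m * (if nf m = v then 1 else 0))"
      proof (rule sum.mono_neutral_cong_left)
        show "\<forall>m\<in>?\<kappa> - M. ?c m * (if nf m = v then 1 else 0) = 0"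
          using inM by fastforce
      qed (use True in \<open>simp_all add: M_def\<close>)
      then show ?thesis
        using True by (simp add: pairing_def)
    qed simp
    also have "\<dots> = 0"
      using kernel[of "\<lambda>m. if nf m = v then 1 else 0"] nf_eq by simp
    finally show "Poly_Mapping.lookup (\<Sum>m\<in>M. if total_degree (nf m) = d then Poly_Mapping.single (nf m) (?c m) else 0) v
        = Poly_Mapping.lookup 0 v"
      by simp
  qed
  finally show ?thesis
    by (simp add: initial_form_def homogeneous_summand_def M_def d_def)
qed

section \<open>Initial forms of binomials\<close>

lemma total_degree_tuple [simp]: "total_degree (a, b, c, d) = a + b + c + d"
  by (simp add: total_degree_def)

lemma keys_binomial:
  "u \<noteq> v \<Longrightarrow> Poly_Mapping.keys (monomial u - monomial v :: 'a \<Rightarrow>\<^sub>0 'k::comm_ring_1) = {u, v}"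
  by (auto simp: in_keys_iff lookup_minus lookup_single when_def split: if_splits)

lemma initial_form_binomial:
  assumes "u \<noteq> v" "total_degree u \<le> total_degree v"
  shows "initial_form (monomial u - monomial v :: 'k::field poly4) =
    monomial u - (if total_degree u = total_degree v then monomial v else 0)"
proof -
  let ?f = "monomial u - monomial v :: 'k poly4"
  have keys: "Poly_Mapping.keys ?f = {u, v}"
    using assms(1) by (rule keys_binomial)
  have coeff: "Poly_Mapping.lookup ?f u = 1" "Poly_Mapping.lookup ?f v = - 1"
    using assms(1) by (simp_all add: lookup_minus lookup_single when_def)
  have min: "Min (total_degree ` Poly_Mapping.keys ?f) = total_degree u"
    using assms(2) by (simp add: keys)
  have "{m \<in> Poly_Mapping.keys ?f. total_degree m = total_degree u} =
      (if total_degree u = total_degree v then {u, v} else {u})"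
    by (auto simp: keys)
  then show ?thesis
    using assms(1) coeff by (simp add: initial_form_def homogeneous_summand_def min single_uminus)
qed

section \<open>Divisibility of monomials\<close>

definition exp_le :: "'a::plus \<Rightarrow> 'a \<Rightarrow> bool" where
  "exp_le u v \<longleftrightarrow> (\<exists>w. v = u + w)"

lemma exp_le_tuple [simp]:
  "exp_le (a, b, c, d) (a', b', c', d' :: nat) \<longleftrightarrow> (a::nat) \<le> a' \<and> (b::nat) \<le> b' \<and> (c::nat) \<le> c' \<and> d \<le> d'"
  by (force simp: exp_le_def le_iff_add)

text \<open>For fixed \<open>m\<close> this describes the monomial ideal spanned by the monomials
  not dividing \<open>m\<close>; an ideal contained in it has no element in which \<open>m\<close>
  occurs.\<close>

definition avoids :: "'a::comm_monoid_add \<Rightarrow> ('a \<Rightarrow>\<^sub>0 'k::comm_ring_1) \<Rightarrow> bool" where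
  "avoids m f \<longleftrightarrow> (\<forall>u\<in>Poly_Mapping.keys f. \<not> exp_le u m)"

lemma avoids_zero [simp]: "avoids m 0"
  by (simp add: avoids_def)

lemma avoids_monomial [simp]: "avoids m (monomial u) \<longleftrightarrow> \<not> exp_le u m"
  by (simp add: avoids_def)

lemma avoids_add: "avoids m f \<Longrightarrow> avoids m g \<Longrightarrow> avoids m (f + g)"
  using keys_add[of f g] by (auto simp: avoids_def)

lemma avoids_uminus [simp]: "avoids m (- f) \<longleftrightarrow> avoids m f"
  by (simp add: avoids_def in_keys_iff)

lemma avoids_diff: "avoids m f \<Longrightarrow> avoids m g \<Longrightarrow> avoids m (f - g)"
  using avoids_add[of m f "- g"] by simp

lemma avoids_mult: "avoids m f \<Longrightarrow> avoids m (h * f)"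
  using keys_mult[of h f] unfolding avoids_def exp_le_def
  by (smt (verit, ccfv_threshold) add.assoc add.commute mem_Collect_eq subsetD)

lemma avoids_imp_lookup_eq_0: "avoids m f \<Longrightarrow> Poly_Mapping.lookup f m = 0"
  unfolding avoids_def exp_le_def by (metis add.right_neutral in_keys_iff)

lemma avoids_genideal:
  assumes "\<And>g. g \<in> F \<Longrightarrow> avoids m g" "f \<in> Idl\<^bsub>ring_of_type_algebra\<^esub> F"
  shows "avoids m f"
proof -
  have "ideal {f. avoids m f} ring_of_type_algebra"
    by (rule ideal_ring_of_type_algebraI) (auto intro: avoids_add avoids_mult)
  then show ?thesis
    using genideal_ring_of_type_algebra(3)[of "{f. avoids m f}" F] assms by auto
qed

text \<open>The monomial \<open>us i\<close> is a witness for the \<open>i\<close>-th generator: it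
  occurs there, but in no element of the ideal generated by the others.\<close>

lemma minimally_generated_byI:
  fixes gs :: "'k::field poly4 list"
  assumes "I = Idl\<^bsub>poly4_ring\<^esub> (set gs)"
    and "\<And>i. i < length gs \<Longrightarrow> Poly_Mapping.lookup (gs ! i) (us i) \<noteq> 0"
    and avoid: "\<And>i j. i < length gs \<Longrightarrow> j < length gs \<Longrightarrow> i \<noteq> j \<Longrightarrow> avoids (us i) (gs ! j)"
  shows "minimally_generated_by poly4_ring I gs"
  unfolding minimally_generated_by_def
proof (intro conjI allI impI)
  show "distinct gs"
    using assms(2,3) avoids_imp_lookup_eq_0 by (metis distinct_conv_nth)
  fix A assume "A \<subset> set gs"
  then obtain i where i: "i < length gs" "gs ! i \<notin> A" and A: "A \<subseteq> set gs"
    by (metis in_set_conv_nth psubset_imp_ex_mem DiffE psubsetE)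
  have "avoids (us i) g" if g: "g \<in> A" for g
  proof -
    obtain j where "j < length gs" "g = gs ! j"
      using g A by (metis in_set_conv_nth subsetD)
    then show ?thesis
      using avoid[of i j] i g by auto
  qed
  then have "gs ! i \<notin> Idl\<^bsub>poly4_ring\<^esub> A"
    using avoids_genideal[of A "us i" "gs ! i"] avoids_imp_lookup_eq_0 assms(2) i(1) by blast
  moreover have "gs ! i \<in> I"
    using genideal_ring_of_type_algebra(2)[of "set gs"] i(1) by (auto simp: assms(1))
  ultimately show "I \<noteq> Idl\<^bsub>poly4_ring\<^esub> A"
    by blast
qed (simp_all add: assms(1))

section \<open>Critical pairs\<close>

fun exp_lcm :: "expo \<Rightarrow> expo \<Rightarrow> expo" where
  "exp_lcm (a, b, c, d) (a', b', c', d') = (max a a', max b b', max c c', max d d')"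

text \<open>The least common multiple is the smallest monomial to which both rules apply; its two
  rewritings correspond to the terms of an S-polynomial.\<close>

definition critical_joinable :: "(expo \<times> expo) set \<Rightarrow> expo \<times> expo \<Rightarrow> expo \<times> expo \<Rightarrow> bool" where
  "critical_joinable R = (\<lambda>(l, r) (l', r').
     joinable (translates R) (r + (exp_lcm l l' - l)) (r' + (exp_lcm l l' - l')))"

lemma exp_lcm_commute: "exp_lcm l l' = exp_lcm l' l"
  by (cases l; cases l') (simp add: max.commute)

lemma critical_joinable_sym: "critical_joinable R \<rho> \<sigma> \<Longrightarrow> critical_joinable R \<sigma> \<rho>"
  by (cases \<rho>; cases \<sigma>) (auto simp: critical_joinable_def exp_lcm_commute intro: joinable_sym)

lemma critical_joinable_refl: "critical_joinable R \<rho> \<rho>"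
  by (cases \<rho>) (auto simp only: critical_joinable_def prod.case intro: joinableI)

text \<open>Buchberger's criterion for coprime left sides: the rules do not interfere, and both
  rewritings lead to \<open>r' + r\<close>.\<close>

lemma critical_joinable_coprime:
  assumes "exp_lcm l l' = l + l'" "(l, r) \<in> R" "(l', r') \<in> R"
  shows "critical_joinable R (l, r) (l', r')"
proof -
  have "(r + l', r' + r) \<in> translates R"
    by (rule translatesI[OF assms(3), of _ r]) (simp_all add: add.commute)
  moreover have "(r' + l, r' + r) \<in> translates R"
    by (rule translatesI[OF assms(2), of _ r']) (simp_all add: add.commute)
  ultimately show ?thesis
    by (auto simp: critical_joinable_def assms(1) intro: joinableI)
qed

text \<open>The cofactor is \<open>u - l\<close>, where truncated subtraction is exact because
  \<open>l\<close> divides \<open>u\<close>.\<close>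

lemma translates_reduce:
  fixes u :: expo
  assumes "(l, r) \<in> R" "exp_le l u" "u - l + r = v"
  shows "(u, v) \<in> translates R"
proof (rule translatesI[OF assms(1)])
  show "u = l + (u - l)"
    using assms(2) by (cases l; cases u) simp
  show "v = r + (u - l)"
    using assms(3) by (simp add: add.commute)
qed

lemma critical_joinableI:
  assumes "r + (exp_lcm l l' - l) = u" "r' + (exp_lcm l l' - l') = v"
    and "(u, z) \<in> (translates R)\<^sup>*" "(v, z) \<in> (translates R)\<^sup>*"
  shows "critical_joinable R (l, r) (l', r')"
  using assms by (auto simp: critical_joinable_def simp del: split_paired_Ex intro: joinableI)

lemma critical_joinableI1:
  assumes "r + (exp_lcm l l' - l) = z" "r' + (exp_lcm l l' - l') = v" "(v, z) \<in> (translates R)\<^sup>*"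
  shows "critical_joinable R (l, r) (l', r')"
  using assms(1,2) rtrancl_refl assms(3) by (rule critical_joinableI)

text \<open>Any two rewritings of \<open>u\<close> are the translate of a critical pair by
  \<open>u - exp_lcm l l'\<close>.\<close>

lemma local_confluence:
  assumes crit: "\<And>\<rho> \<sigma>. \<rho> \<in> R \<Longrightarrow> \<sigma> \<in> R \<Longrightarrow> critical_joinable R \<rho> \<sigma>"
    and "(u, v) \<in> translates R" "(u, v') \<in> translates R"
  shows "joinable (translates R) v v'"
proof -
  obtain l r w l' r' w' where lr: "(l, r) \<in> R" "(l', r') \<in> R"
    and u: "u = l + w" "u = l' + w'" and v: "v = r + w" "v' = r' + w'"
    using assms(2,3) by (elim translatesE)
  define t where "t = u - exp_lcm l l'"
  have "w = (exp_lcm l l' - l) + t" "w' = (exp_lcm l l' - l') + t"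
    using u unfolding t_def
    by (cases l; cases l'; cases w; cases w'; auto simp: max_def)+
  then have "v = r + (exp_lcm l l' - l) + t" "v' = r' + (exp_lcm l l' - l') + t"
    by (simp_all add: v add.assoc)
  then show ?thesis
    using joinable_translates_add[of R _ _ t] crit[OF lr] by (simp add: critical_joinable_def)
qed

lemma sorted_wrt_imp_all_pairs:
  assumes "sorted_wrt P xs" "\<And>x y. P x y \<Longrightarrow> P y x" "\<And>x. P x x" "x \<in> set xs" "y \<in> set xs"
  shows "P x y"
  using assms(1,4,5) by (induction xs) (auto intro: assms(2,3))

section \<open>Monomial curves\<close>

definition curve_weight :: "nat \<Rightarrow> nat \<Rightarrow> nat \<Rightarrow> nat \<Rightarrow> expo \<Rightarrow> nat" where
  "curve_weight n\<^sub>1 n\<^sub>2 n\<^sub>3 n\<^sub>4 = (\<lambda>(a, b, c, d). a * n\<^sub>1 + b * n\<^sub>2 + c * n\<^sub>3 + d * n\<^sub>4)"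

lemma curve_weight_tuple [simp]:
  "curve_weight n\<^sub>1 n\<^sub>2 n\<^sub>3 n\<^sub>4 (a, b, c, d) = a * n\<^sub>1 + b * n\<^sub>2 + c * n\<^sub>3 + d * n\<^sub>4"
  by (simp add: curve_weight_def)

text \<open>A monomial is sent to the power of the variable given by its weight, so each coefficient
  of the image is a functional of the above kind.\<close>

lemma coeff_curve_hom:
  "coeff (curve_hom n\<^sub>1 n\<^sub>2 n\<^sub>3 n\<^sub>4 f) s =
     pairing (\<lambda>m. if curve_weight n\<^sub>1 n\<^sub>2 n\<^sub>3 n\<^sub>4 m = s then 1 else 0) f"
proof -
  have "([:0, 1:] ^ n\<^sub>1) ^ a * ([:0, 1:] ^ n\<^sub>2) ^ b * ([:0, 1:] ^ n\<^sub>3) ^ c * ([:0, 1:] ^ n\<^sub>4) ^ d =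
      monom (1::'a) (curve_weight n\<^sub>1 n\<^sub>2 n\<^sub>3 n\<^sub>4 (a, b, c, d))" for a b c d
    by (simp add: monom_altdef ac_simps flip: power_mult power_add)
  then show ?thesis
    by (simp add: curve_hom_def pairing_def Let_def coeff_sum case_prod_beta' coeff_monom
        smult_monom if_distrib[of "(*) _"] del: curve_weight_tuple cong: if_cong)
qed

lemma binomial_in_curve_ideal:
  "monomial u - monomial v \<in> (curve_ideal n\<^sub>1 n\<^sub>2 n\<^sub>3 n\<^sub>4 :: 'k::field poly4 set) \<longleftrightarrow>
     curve_weight n\<^sub>1 n\<^sub>2 n\<^sub>3 n\<^sub>4 u = curve_weight n\<^sub>1 n\<^sub>2 n\<^sub>3 n\<^sub>4 v"
  by (auto simp: curve_ideal_def poly_eq_iff coeff_curve_hom pairing_diff)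

lemma X_powers:
  "X\<^sub>1 ^ k = (monomial (k, 0, 0, 0) :: 'k::field poly4)"
  "X\<^sub>2 ^ k = (monomial (0, k, 0, 0) :: 'k::field poly4)"
  "X\<^sub>3 ^ k = (monomial (0, 0, k, 0) :: 'k::field poly4)"
  "X\<^sub>4 ^ k = (monomial (0, 0, 0, k) :: 'k::field poly4)"
  by (induction k)
    (simp_all add: X\<^sub>1_def X\<^sub>2_def X\<^sub>3_def X\<^sub>4_def mult_single flip: single_one zero_prod_def)

text \<open>Weight is invariant while degree plus \<open>x\<^sub>1\<close>-exponent grows; the
  latter is at most twice the weight, so the difference is a decreasing measure.\<close>

lemma wf_converse_translates:
  assumes "0 < n\<^sub>1" "0 < n\<^sub>2" "0 < n\<^sub>3" "0 < n\<^sub>4"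
    and R: "\<And>l r. (l, r) \<in> R \<Longrightarrow> curve_weight n\<^sub>1 n\<^sub>2 n\<^sub>3 n\<^sub>4 l = curve_weight n\<^sub>1 n\<^sub>2 n\<^sub>3 n\<^sub>4 r \<and>
                 total_degree l + fst l < total_degree r + fst r"
  shows "wf ((translates R)\<inverse>)"
proof -
  let ?w = "curve_weight n\<^sub>1 n\<^sub>2 n\<^sub>3 n\<^sub>4"
  let ?d = "\<lambda>u. total_degree u + fst u"
  \<comment> \<open>Each exponent is at most its contribution to the weight; the factor 2 accounts
    for the first one being counted twice.\<close>
  have bound: "?d u \<le> 2 * ?w u" for u
  proof -
    have "x \<le> x * n" if "0 < n" for x n :: nat
      using that by simp
    note le = this[OF assms(1)] this[OF assms(2)] this[OF assms(3)] this[OF assms(4)]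
    obtain a b c d where u: "u = (a, b, c, d)"
      by (cases u)
    have "a + b + c + d + a \<le> 2 * (p + q + r + s)" if "a \<le> p" "b \<le> q" "c \<le> r" "d \<le> s" for p q r s
      using that by simp
    from this[OF le] show ?thesis
      by (simp add: u)
  qed
  have add: "?w (u + v) = ?w u + ?w v" "?d (u + v) = ?d u + ?d v" for u v
    by (cases u; cases v; simp add: algebra_simps)+
  have "(translates R)\<inverse> \<subseteq> measure (\<lambda>u. 2 * ?w u - ?d u)"
  proof clarify
    fix v u assume "(u, v) \<in> translates R"
    then obtain l r w where lr: "(l, r) \<in> R" "u = l + w" "v = r + w"
      by (rule translatesE)
    have "?w u = ?w v" "?d u < ?d v"
      unfolding lr(2,3) add using R[OF lr(1)] by simp_all
    then show "(v, u) \<in> measure (\<lambda>u. 2 * ?w u - ?d u)"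
      using bound[of v] by simp
  qed
  then show ?thesis
    by (rule wf_subset[OF wf_measure])
qed

section \<open>A rewriting criterion for minimal generators of the initial ideal\<close>

theorem initial_ideal_minimally_generated:
  fixes I F :: "'k::field poly4 set"
  assumes I: "I = curve_ideal n\<^sub>1 n\<^sub>2 n\<^sub>3 n\<^sub>4" "0 < n\<^sub>1" "0 < n\<^sub>2" "0 < n\<^sub>3" "0 < n\<^sub>4"
    and gen: "I = Idl\<^bsub>poly4_ring\<^esub> F"
    and F: "\<And>g. g \<in> F \<Longrightarrow> \<exists>u v. (u, v) \<in> set rs \<union> (set rs)\<inverse> \<and> g = monomial u - monomial v"
    and rs: "\<And>l r. (l, r) \<in> set rs \<Longrightarrow> curve_weight n\<^sub>1 n\<^sub>2 n\<^sub>3 n\<^sub>4 l = curve_weight n\<^sub>1 n\<^sub>2 n\<^sub>3 n\<^sub>4 r \<and>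
               total_degree l \<le> total_degree r \<and>
               total_degree l + fst l < total_degree r + fst r \<and> fst l = 0"
    and crit: "sorted_wrt (critical_joinable (set rs)) rs"
    and antichain: "sorted_wrt (\<lambda>(l, r) (l', r'). \<not> exp_le l l' \<and> \<not> exp_le l' l) rs"
    and gs: "list_all2 (\<lambda>g (l, r). \<exists>h. h = monomial l - (if total_degree l = total_degree r then monomial r else 0)
               \<and> (g = h \<or> g = - h)) gs rs"
  shows "minimally_generated_by poly4_ring (initial_ideal I) gs"
proof -
  define h :: "nat \<Rightarrow> 'k poly4" where "h i = (case rs ! i of (l, r) \<Rightarrow>
    monomial l - (if total_degree l = total_degree r then monomial r else 0))" for i
  have len: "length gs = length rs"
    using gs by (rule list_all2_lengthD)
  have gsh: "gs ! i = h i \<or> gs ! i = - h i" if "i < length rs" for i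
    using list_all2_nthD2[OF gs that] by (auto simp: h_def split: prod.splits)
  let ?J = "Idl\<^bsub>poly4_ring\<^esub> (set gs)"
  note J = genideal_ring_of_type_algebra(1)[of "set gs"]
  have hJ: "h i \<in> ?J" if i: "i < length rs" for i
  proof -
    have "gs ! i \<in> ?J"
      using genideal_ring_of_type_algebra(2)[of "set gs"] i len by auto
    then show ?thesis
      using gsh[OF i] ideal_ring_of_type_algebraD(3)[OF J, of "gs ! i" "- 1"] by auto
  qed
  have red: "total_degree l \<le> total_degree r \<and>
      monomial l - (if total_degree l = total_degree r then monomial r else 0) \<in> ?J"
    if lr: "(l, r) \<in> set rs" for l r
  proof -
    obtain i where "i < length rs" "rs ! i = (l, r)"
      using lr by (metis in_set_conv_nth)
    then show ?thesis
      using rs[OF lr] hJ[of i] by (simp add: h_def)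
  qed
  have wf: "wf ((translates (set rs))\<inverse>)"
    by (rule wf_converse_translates[OF I(2-5)]) (use rs in blast)
  have all: "critical_joinable (set rs) \<rho> \<sigma>" if "\<rho> \<in> set rs" "\<sigma> \<in> set rs" for \<rho> \<sigma>
    using sorted_wrt_imp_all_pairs[OF crit _ _ that] critical_joinable_sym critical_joinable_refl by blast
  have confl: "joinable (translates (set rs)) v v'"
    if "(u, v) \<in> translates (set rs)" "(u, v') \<in> translates (set rs)" for u v v'
    using all that by (rule local_confluence)
  have "initial_form f \<in> ?J" if "f \<in> I" "f \<noteq> 0" for f
    using J wf confl red F that unfolding gen by (rule initial_form_in_ideal)
  then have "{initial_form f |f. f \<in> I \<and> f \<noteq> 0} \<subseteq> ?J"
    by blast
  then have sub1: "initial_ideal I \<subseteq> ?J"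
    unfolding initial_ideal_def using genideal_ring_of_type_algebra(3)[OF J] by blast
  note K = genideal_ring_of_type_algebra(1,2)[of "{initial_form f |f. f \<in> I \<and> f \<noteq> 0}",
      folded initial_ideal_def]
  \<comment> \<open>The reverse inclusion: rules preserve the weight, so every rule gives a binomial
    of \<open>I\<close>, also one that is not in \<open>F\<close>, and \<open>h i\<close> is its
    initial form.\<close>
  have "gs ! i \<in> initial_ideal I" if i: "i < length rs" for i
  proof -
    obtain l r where lr: "rs ! i = (l, r)" by (metis surj_pair)
    then have mem: "(l, r) \<in> set rs"
      using i nth_mem[of i rs] by simp
    have ne: "l \<noteq> r"
      using rs[OF mem] by auto
    then have "monomial l - monomial r \<noteq> (0 :: 'k poly4)"
      using keys_binomial[OF ne, where 'k = 'k] by (metis insert_not_empty keys_zero)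
    moreover have "monomial l - monomial r \<in> I"
      using rs[OF mem] unfolding I(1) by (simp add: binomial_in_curve_ideal)
    ultimately have "initial_form (monomial l - monomial r) \<in> initial_ideal I"
      using K(2) by blast
    moreover have "initial_form (monomial l - monomial r) = h i"
      using rs[OF mem] by (simp add: h_def lr initial_form_binomial[OF ne])
    ultimately have "h i \<in> initial_ideal I"
      by simp
    then show ?thesis
      using gsh[OF i] ideal_ring_of_type_algebraD(3)[OF K(1), of "h i" "- 1"] by auto
  qed
  then have "set gs \<subseteq> initial_ideal I"
    using len by (auto simp: in_set_conv_nth)
  then have eq: "initial_ideal I = ?J"
    using sub1 genideal_ring_of_type_algebra(3)[OF K(1)] by blast
  show ?thesis
  proof (rule minimally_generated_byI[where us = "\<lambda>i. fst (rs ! i)"])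
    fix i assume i: "i < length gs"
    obtain l r where lr: "rs ! i = (l, r)" by (metis surj_pair)
    have "(l, r) \<in> set rs"
      using i len nth_mem[of i rs] by (simp add: lr)
    from rs[OF this] have "l \<noteq> r"
      by auto
    then show "Poly_Mapping.lookup (gs ! i) (fst (rs ! i)) \<noteq> 0"
      using gsh[of i] i len lr by (auto simp: h_def lookup_minus lookup_single when_def split: if_splits)
    fix j assume j: "j < length gs" "i \<noteq> j"
    obtain l' r' where lr': "rs ! j = (l', r')" by (metis surj_pair)
    have "(l, r) \<in> set rs" "(l', r') \<in> set rs"
      using i j nth_mem[of i rs] nth_mem[of j rs] by (simp_all add: lr lr' len)
    note R = rs[OF this(1)] rs[OF this(2)]
    have "\<not> exp_le l' l"
      using sorted_wrt_nth_less[OF antichain, of i j] sorted_wrt_nth_less[OF antichain, of j i]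
        i j len lr lr' by (cases "i < j") auto
    moreover have "\<not> exp_le r' l" if "total_degree l' = total_degree r'"
      using R that by (auto simp: exp_le_def)
    ultimately show "avoids (fst (rs ! i)) (gs ! j)"
      using gsh[of j] j len lr lr' by (auto simp: h_def intro!: avoids_diff)
  qed (fact eq)
qed

section \<open>Gorenstein curves of Bresinsky's form\<close>

locale bresinsky_curve =
  fixes n1 n2 n3 n4 a1 a2 a3 a4 a13 a14 a21 a23 a32 a34 a41 a42 :: nat
    and I :: "'k::field poly4 set"
  assumes I: "I = curve_ideal n1 n2 n3 n4"
    and n: "0 < n1" "n1 < n2" "n2 < n3" "n3 < n4"
    and gen: "I = Idl\<^bsub>poly4_ring\<^esub>
          {monomial (a1, 0, 0, 0) - monomial (0, 0, a13, a14),
           monomial (0, a2, 0, 0) - monomial (a21, 0, a23, 0),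
           monomial (0, 0, a3, 0) - monomial (0, a32, 0, a34),
           monomial (0, 0, 0, a4) - monomial (a41, a42, 0, 0),
           monomial (a21, 0, 0, a34) - monomial (0, a42, a13, 0)}"
    and pos: "0 < a13" "0 < a14" "0 < a21" "0 < a23" "0 < a32" "0 < a34" "0 < a41" "0 < a42"
    and less: "a13 < a3" "a14 < a4" "a21 < a1" "a23 < a3" "a32 < a2" "a34 < a4" "a41 < a1" "a42 < a2"
    and a42: "a42 \<le> a32"
begin

abbreviation "wt \<equiv> curve_weight n1 n2 n3 n4"

section \<open>Relations between the exponents\<close>

lemma gen_weights:
  "wt (a1, 0, 0, 0) = wt (0, 0, a13, a14)"
  "wt (0, a2, 0, 0) = wt (a21, 0, a23, 0)"
  "wt (0, 0, a3, 0) = wt (0, a32, 0, a34)"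
  "wt (0, 0, 0, a4) = wt (a41, a42, 0, 0)"
  "wt (a21, 0, 0, a34) = wt (0, a42, a13, 0)"
proof -
  have "monomial (a1, 0, 0, 0) - monomial (0, 0, a13, a14) \<in> I"
    "monomial (0, a2, 0, 0) - monomial (a21, 0, a23, 0) \<in> I"
    "monomial (0, 0, a3, 0) - monomial (0, a32, 0, a34) \<in> I"
    "monomial (0, 0, 0, a4) - monomial (a41, a42, 0, 0) \<in> I"
    "monomial (a21, 0, 0, a34) - monomial (0, a42, a13, 0) \<in> I"
    unfolding gen by (rule subsetD[OF genideal_ring_of_type_algebra(2)], simp)+
  then show "wt (a1, 0, 0, 0) = wt (0, 0, a13, a14)"
    "wt (0, a2, 0, 0) = wt (a21, 0, a23, 0)"
    "wt (0, 0, a3, 0) = wt (0, a32, 0, a34)"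
    "wt (0, 0, 0, a4) = wt (a41, a42, 0, 0)"
    "wt (a21, 0, 0, a34) = wt (0, a42, a13, 0)"
    unfolding I binomial_in_curve_ideal .
qed

text \<open>Such an \<open>m\<close> avoids all generators and therefore occurs in no element of
  \<open>I\<close>, whereas the binomial \<open>m - m'\<close> lies in \<open>I\<close> by equality
  of weights.\<close>

lemma isolated_monomial:
  assumes "\<not> exp_le (a1, 0, 0, 0) m" "\<not> exp_le (0, 0, a13, a14) m"
    "\<not> exp_le (0, a2, 0, 0) m" "\<not> exp_le (a21, 0, a23, 0) m"
    "\<not> exp_le (0, 0, a3, 0) m" "\<not> exp_le (0, a32, 0, a34) m"
    "\<not> exp_le (0, 0, 0, a4) m" "\<not> exp_le (a41, a42, 0, 0) m"
    "\<not> exp_le (a21, 0, 0, a34) m" "\<not> exp_le (0, a42, a13, 0) m"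
    and "wt m = wt m'"
  shows "m = m'"
proof (rule ccontr)
  assume "m \<noteq> m'"
  let ?f = "monomial m - monomial m' :: 'k poly4"
  have "?f \<in> I"
    unfolding I binomial_in_curve_ideal by fact
  note f = this[unfolded gen]
  have "avoids m ?f"
    by (rule avoids_genideal[OF _ f], insert assms(1-10), elim insertE emptyE)
      (simp_all only: avoids_diff avoids_monomial not_False_eq_True)
  then have "Poly_Mapping.lookup ?f m = 0"
    by (rule avoids_imp_lookup_eq_0)
  then show False
    using \<open>m \<noteq> m'\<close> by (simp add: lookup_minus lookup_single when_def)
qed

text \<open>Weight equations of the generators are combined until one side is the weight of a pure
  power below the critical exponent; such a power is isolated, so the other side is the same
  monomial.\<close>

lemma relations: "a1 = a21 + a41" "a2 = a32 + a42" "a3 = a13 + a23" "a4 = a14 + a34"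
proof -
  note w = gen_weights[simplified]
  have "a3 = a13 + a23 \<and> a2 = a32 + a42"
  proof -
    obtain k where k: "a2 = a42 + k" "0 < k"
      using less(8) less_imp_add_positive by blast
    \<comment> \<open>Adding the weight equations of the second and fifth generators and cancelling
      \<open>x1^a21\<close> and \<open>x2^a42\<close>.\<close>
    have e: "wt (0, 0, a13 + a23, 0) = wt (0, k, 0, a34)"
      using w(2,5) by (simp add: k(1) add_mult_distrib)
    have "a3 \<le> a13 + a23"
    proof (rule ccontr)
      assume "\<not> ?thesis"
      then have "(0, 0, a13 + a23, 0) = ((0, k, 0, a34) :: expo)"
        using pos less by (intro isolated_monomial e) auto
      then show False
        using pos by simp
    qed
    then obtain j where j: "a13 + a23 = a3 + j"
      using le_Suc_ex by blast
    have "wt (0, k, 0, 0) = wt (0, a32, j, 0)"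
      using e[unfolded j] w(3) by (simp add: add_mult_distrib)
    then have "(0, k, 0, 0) = ((0, a32, j, 0) :: expo)"
      using pos less k by (intro isolated_monomial) auto
    then show ?thesis
      using j k by simp
  qed
  moreover have "a4 = a14 + a34 \<and> a1 = a21 + a41"
  proof -
    obtain k where k: "a1 = a21 + k" "0 < k"
      using less(3) less_imp_add_positive by blast
    \<comment> \<open>The same argument with the first and fifth generators, then with the fourth
      one to reach a pure power of \<open>x\<^sub>1\<close>.\<close>
    have e: "wt (0, 0, 0, a14 + a34) = wt (k, a42, 0, 0)"
      using w(1,5) by (simp add: k(1) add_mult_distrib)
    have "a4 \<le> a14 + a34"
    proof (rule ccontr)
      assume "\<not> ?thesis"
      then have "(0, 0, 0, a14 + a34) = ((k, a42, 0, 0) :: expo)"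
        using pos less by (intro isolated_monomial e) auto
      then show False
        using pos by simp
    qed
    then obtain j where j: "a14 + a34 = a4 + j"
      using le_Suc_ex by blast
    have "wt (k, 0, 0, 0) = wt (a41, 0, 0, j)"
      using e[unfolded j] w(4) by (simp add: add_mult_distrib)
    then have "(k, 0, 0, 0) = ((a41, 0, 0, j) :: expo)"
      using pos less k by (intro isolated_monomial) auto
    then show ?thesis
      using j k by simp
  qed
  ultimately show "a1 = a21 + a41" "a2 = a32 + a42" "a3 = a13 + a23" "a4 = a14 + a34"
    by auto
qed

section \<open>The six rewriting rules and their critical pairs\<close>

text \<open>The sixth rule arises from the overlap of the third and the fifth:
  \<open>x2^a32 * x3^a13 * x4^a34\<close> rewrites to \<open>x3^(a3 + a13)\<close> and to
  \<open>x1^a21 * x2^(a32 - a42) * x4^(2 * a34)\<close>. If \<open>a14 \<le> a34\<close>, the latter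
  is divisible by \<open>x4^a4\<close> and rewrites further, whence the two choices of
  \<open>q\<close>.\<close>

definition rules :: "expo \<Rightarrow> (expo \<times> expo) list" where
  "rules q = [((0, 0, a13, a14), (a1, 0, 0, 0)), ((0, a2, 0, 0), (a21, 0, a23, 0)),
    ((0, a32, 0, a34), (0, 0, a3, 0)), ((0, 0, 0, a4), (a41, a42, 0, 0)),
    ((0, a42, a13, 0), (a21, 0, 0, a34)), ((0, 0, a3 + a13, 0), q)]"

lemma reduce:
  "exp_le (0, 0, a13, a14) u \<Longrightarrow> u - (0, 0, a13, a14) + (a1, 0, 0, 0) = v \<Longrightarrow> (u, v) \<in> translates (set (rules q))"
  "exp_le (0, a2, 0, 0) u \<Longrightarrow> u - (0, a2, 0, 0) + (a21, 0, a23, 0) = v \<Longrightarrow> (u, v) \<in> translates (set (rules q))"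
  "exp_le (0, a32, 0, a34) u \<Longrightarrow> u - (0, a32, 0, a34) + (0, 0, a3, 0) = v \<Longrightarrow> (u, v) \<in> translates (set (rules q))"
  "exp_le (0, 0, 0, a4) u \<Longrightarrow> u - (0, 0, 0, a4) + (a41, a42, 0, 0) = v \<Longrightarrow> (u, v) \<in> translates (set (rules q))"
  "exp_le (0, a42, a13, 0) u \<Longrightarrow> u - (0, a42, a13, 0) + (a21, 0, 0, a34) = v \<Longrightarrow> (u, v) \<in> translates (set (rules q))"
  "exp_le (0, 0, a3 + a13, 0) u \<Longrightarrow> u - (0, 0, a3 + a13, 0) + q = v \<Longrightarrow> (u, v) \<in> translates (set (rules q))"
  by (erule (1) translates_reduce[rotated]; simp add: rules_def)+

text \<open>Of the fifteen pairs six have coprime left sides; the other nine are computed, the fact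
  \<open>13\<close> being the pair of the first and third rule, and so on. \<open>crit1\<close>
  serves when one rewriting is already the common reduct.\<close>

lemma critical_joinable_rules:
  fixes q :: expo
  defines "S \<equiv> translates (set (rules q))"
  assumes 1: "a34 < a14 \<and> q = (a21, a32 - a42, 0, 2 * a34) \<or> a14 \<le> a34 \<and> q = (a1, a32, 0, a34 - a14)"
  shows "sorted_wrt (critical_joinable (set (rules q))) (rules q)"
proof -
  note rel = relations
  note red = reduce[where q = q, folded S_def, THEN r_into_rtrancl]
  note crit = critical_joinableI[where R = "set (rules q)", folded S_def]
  note crit1 = critical_joinableI1[where R = "set (rules q)", folded S_def]
  note coprime = critical_joinable_coprime[where R = "set (rules q)"]
  have 13: "critical_joinable (set (rules q)) ((0, 0, a13, a14), (a1, 0, 0, 0)) ((0, a32, 0, a34), (0, 0, a3, 0))"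
    using 1
  proof (elim disjE conjE)
    assume *: "a34 < a14" "q = (a21, a32 - a42, 0, 2 * a34)"
    have "((0, 0, a3 + a13, a14 - a34), (a21, a32 - a42, 0, a34 + a14)) \<in> S\<^sup>*"
      by (rule red(6)) (use * in simp_all)
    also have "((a21, a32 - a42, 0, a34 + a14), (a1, a32, 0, 0)) \<in> S\<^sup>*"
      by (rule red(4)) (use rel a42 in simp_all)
    finally show ?thesis
      by (rule crit1[rotated 2]) (use * in simp_all)
  next
    \<comment> \<open>Here the critical pair consists of the two sides of the sixth rule.\<close>
    assume *: "a14 \<le> a34" "q = (a1, a32, 0, a34 - a14)"
    have "((0, 0, a3 + a13, 0), (a1, a32, 0, a34 - a14)) \<in> S\<^sup>*"
      by (rule red(6)) (use * in simp_all)
    then show ?thesis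
      by (rule crit1[rotated 2]) (use * in simp_all)
  qed
  have 14: "critical_joinable (set (rules q)) ((0, 0, a13, a14), (a1, 0, 0, 0)) ((0, 0, 0, a4), (a41, a42, 0, 0))"
  proof -
    have "((a41, a42, a13, 0), (a1, 0, 0, a34)) \<in> S\<^sup>*"
      by (rule red(5)) (use rel in simp_all)
    then show ?thesis
      by (rule crit1[rotated 2]) (use rel in simp_all)
  qed
  have 15: "critical_joinable (set (rules q)) ((0, 0, a13, a14), (a1, 0, 0, 0)) ((0, a42, a13, 0), (a21, 0, 0, a34))"
  proof -
    have "((a21, 0, 0, a34 + a14), (a1, a42, 0, 0)) \<in> S\<^sup>*"
      by (rule red(4)) (use rel in simp_all)
    then show ?thesis
      by (rule crit1[rotated 2]) (use rel in simp_all)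
  qed
  have 16: "critical_joinable (set (rules q)) ((0, 0, a13, a14), (a1, 0, 0, 0)) ((0, 0, a3 + a13, 0), q)"
  proof -
    have r: "((a1, a32, 0, a34), (a1, 0, a3, 0)) \<in> S\<^sup>*"
      by (rule red(3)) simp_all
    from 1 show ?thesis
    proof (elim disjE conjE)
      assume *: "a34 < a14" "q = (a21, a32 - a42, 0, 2 * a34)"
      have "((a21, a32 - a42, 0, 2 * a34 + a14), (a1, a32, 0, a34)) \<in> S\<^sup>*"
        by (rule red(4)) (use rel a42 in simp_all)
      from rtrancl_trans[OF this r] show ?thesis
        by (rule crit1[rotated 2]) (use * in simp_all)
    next
      assume *: "a14 \<le> a34" "q = (a1, a32, 0, a34 - a14)"
      from r show ?thesis
        by (rule crit1[rotated 2]) (use * in simp_all)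
    qed
  qed
  have 23: "critical_joinable (set (rules q)) ((0, a2, 0, 0), (a21, 0, a23, 0)) ((0, a32, 0, a34), (0, 0, a3, 0))"
  proof -
    have "((0, a42, a3, 0), (a21, 0, a23, a34)) \<in> S\<^sup>*"
      by (rule red(5)) (use rel in simp_all)
    then show ?thesis
      by (rule crit1[rotated 2]) (use rel in simp_all)
  qed
  have 25: "critical_joinable (set (rules q)) ((0, a2, 0, 0), (a21, 0, a23, 0)) ((0, a42, a13, 0), (a21, 0, 0, a34))"
  proof -
    have "((a21, a32, 0, a34), (a21, 0, a3, 0)) \<in> S\<^sup>*"
      by (rule red(3)) (use rel in simp_all)
    then show ?thesis
      by (rule crit1[rotated 2]) (use rel in simp_all)
  qed
  have 34: "critical_joinable (set (rules q)) ((0, a32, 0, a34), (0, 0, a3, 0)) ((0, 0, 0, a4), (a41, a42, 0, 0))"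
  proof -
    \<comment> \<open>Both rewritings of the overlap have to be reduced once more before they
      meet.\<close>
    have "((0, 0, a3, a14), (a1, 0, a23, 0)) \<in> S\<^sup>*"
      by (rule red(1)) (use rel in simp_all)
    moreover have "((a41, a2, 0, 0), (a1, 0, a23, 0)) \<in> S\<^sup>*"
      by (rule red(2)) (use rel in simp_all)
    ultimately show ?thesis
      by (rule crit[rotated 2]) (use rel in simp_all)
  qed
  have 35: "critical_joinable (set (rules q)) ((0, a32, 0, a34), (0, 0, a3, 0)) ((0, a42, a13, 0), (a21, 0, 0, a34))"
  proof -
    have r: "((0, 0, a3 + a13, 0), q) \<in> S\<^sup>*"
      by (rule red(6)) (cases q, simp)+
    from 1 show ?thesis
    proof (elim disjE conjE)
      assume *: "a34 < a14" "q = (a21, a32 - a42, 0, 2 * a34)"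
      from r rtrancl_refl[of q] show ?thesis
        by (rule crit[rotated 2]) (use * a42 in simp_all)
    next
      assume *: "a14 \<le> a34" "q = (a1, a32, 0, a34 - a14)"
      \<comment> \<open>The fourth rule applies because \<open>a4 = a14 + a34\<close> is at most
        \<open>2 * a34\<close>.\<close>
      have "((a21, a32 - a42, 0, 2 * a34), q) \<in> S\<^sup>*"
        by (rule red(4)) (use * rel a42 in simp_all)
      with r show ?thesis
        by (rule crit[rotated 2]) (use a42 in simp_all)
    qed
  qed
  have 56: "critical_joinable (set (rules q)) ((0, a42, a13, 0), (a21, 0, 0, a34)) ((0, 0, a3 + a13, 0), q)"
    using 1
  proof (elim disjE conjE)
    assume *: "a34 < a14" "q = (a21, a32 - a42, 0, 2 * a34)"
    have "((a21, a32, 0, 2 * a34), (a21, 0, a3, a34)) \<in> S\<^sup>*"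
      by (rule red(3)) simp_all
    then show ?thesis
      by (rule crit1[rotated 2]) (use * a42 in simp_all)
  next
    assume *: "a14 \<le> a34" "q = (a1, a32, 0, a34 - a14)"
    have "((a21, 0, a3, a34), (a21 + a1, 0, a23, a34 - a14)) \<in> S\<^sup>*"
      by (rule red(1)) (use * rel in simp_all)
    moreover have "((a1, a2, 0, a34 - a14), (a21 + a1, 0, a23, a34 - a14)) \<in> S\<^sup>*"
      by (rule red(2)) simp_all
    ultimately show ?thesis
      by (rule crit[rotated 2]) (use * rel in simp_all)
  qed
  have "critical_joinable (set (rules q)) ((0, 0, a13, a14), (a1, 0, 0, 0)) ((0, a2, 0, 0), (a21, 0, a23, 0))"
    "critical_joinable (set (rules q)) ((0, a2, 0, 0), (a21, 0, a23, 0)) ((0, 0, 0, a4), (a41, a42, 0, 0))"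
    "critical_joinable (set (rules q)) ((0, a2, 0, 0), (a21, 0, a23, 0)) ((0, 0, a3 + a13, 0), q)"
    "critical_joinable (set (rules q)) ((0, a32, 0, a34), (0, 0, a3, 0)) ((0, 0, a3 + a13, 0), q)"
    "critical_joinable (set (rules q)) ((0, 0, 0, a4), (a41, a42, 0, 0)) ((0, a42, a13, 0), (a21, 0, 0, a34))"
    "critical_joinable (set (rules q)) ((0, 0, 0, a4), (a41, a42, 0, 0)) ((0, 0, a3 + a13, 0), q)"
    by (rule coprime; simp add: rules_def)+
  with 13 14 15 16 23 25 34 35 56 show ?thesis
    \<comment> \<open>Only the list is unfolded; the rule set inside the relation stays folded so
      that it matches the collected facts.\<close>
    by (subst (2) rules_def) simp
qed

section \<open>Degrees of the binomials and the initial ideal\<close>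

text \<open>\<open>x\<^sub>1\<close> has the smallest weight, so its pure power needs more factors
  to reach the same weight.\<close>

lemma degree_f1: "a13 + a14 < a1"
proof -
  have "(a13 + a14) * n1 < a13 * n3 + a14 * n4"
    using n pos by (simp add: add_mult_distrib add_strict_mono)
  also have "\<dots> = a1 * n1"
    using gen_weights(1) by simp
  finally show ?thesis
    by simp
qed

text \<open>Dually, \<open>x\<^sub>4\<close> has the largest weight, so its pure power needs fewer
  factors.\<close>

lemma degree_f4: "a4 < a41 + a42"
proof -
  have "a4 * n4 = a41 * n1 + a42 * n2"
    using gen_weights(4) by simp
  also have "\<dots> < (a41 + a42) * n4"
    using n pos by (simp add: add_mult_distrib add_strict_mono)
  finally show ?thesis
    by simp
qed

lemma initial_ideal_generators:
  fixes q :: expo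
  assumes q: "a34 < a14 \<and> q = (a21, a32 - a42, 0, 2 * a34) \<or> a14 \<le> a34 \<and> q = (a1, a32, 0, a34 - a14)"
    and deg: "a3 > a32 + a34" "a2 \<le> a21 + a23" "a42 + a13 \<le> a21 + a34" "a3 + a13 \<le> total_degree q"
    and gs: "list_all2 (\<lambda>g (l, r). \<exists>h. h = monomial l - (if total_degree l = total_degree r then monomial r else 0)
               \<and> (g = h \<or> g = - h)) gs (rules q)"
  shows "minimally_generated_by poly4_ring (initial_ideal I) gs"
proof (rule initial_ideal_minimally_generated[OF I _ _ _ _ gen _ _ critical_joinable_rules[OF q] _ gs])
  note w = gen_weights(1,3,5)[simplified]
  \<comment> \<open>The weight equation of the third generator is combined with that of the fifth in
    the first case and of the first in the second; \<open>k\<close> removes the truncated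
    subtraction.\<close>
  have wq: "wt (0, 0, a3 + a13, 0) = wt q"
    using q
  proof (elim disjE conjE)
    assume *: "q = (a21, a32 - a42, 0, 2 * a34)"
    obtain k where "a32 = a42 + k"
      using a42 le_Suc_ex by blast
    then show ?thesis
      using w by (simp add: * add_mult_distrib)
  next
    assume *: "a14 \<le> a34" "q = (a1, a32, 0, a34 - a14)"
    obtain k where "a34 = a14 + k"
      using *(1) le_Suc_ex by blast
    then show ?thesis
      using w by (simp add: *(2) add_mult_distrib)
  qed
  show "wt l = wt r \<and> total_degree l \<le> total_degree r \<and>
      total_degree l + fst l < total_degree r + fst r \<and> fst l = 0" if "(l, r) \<in> set (rules q)" for l r
  proof -
    \<comment> \<open>This makes the sixth rule strictly increasing even when its two sides have
      equal degree.\<close>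
    have "0 < fst q"
      using q pos less by auto
    then have "\<forall>(l, r)\<in>set (rules q). total_degree l \<le> total_degree r \<and>
        total_degree l + fst l < total_degree r + fst r \<and> fst l = 0"
      using deg degree_f1 degree_f4 pos by (simp add: rules_def)
    moreover have "\<forall>(l, r)\<in>set (rules q). wt l = wt r"
      using gen_weights wq by (simp add: rules_def del: curve_weight_tuple)
    ultimately show ?thesis
      using that by blast
  qed
  show "\<exists>u v. (u, v) \<in> set (rules q) \<union> (set (rules q))\<inverse> \<and> g = monomial u - monomial v"
    if "g \<in> {monomial (a1, 0, 0, 0) - monomial (0, 0, a13, a14),
           monomial (0, a2, 0, 0) - monomial (a21, 0, a23, 0),
           monomial (0, 0, a3, 0) - monomial (0, a32, 0, a34),
           monomial (0, 0, 0, a4) - monomial (a41, a42, 0, 0),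
           monomial (a21, 0, 0, a34) - monomial (0, a42, a13, 0)}" for g :: "'k poly4"
    by (insert that, elim insertE emptyE; (intro exI, rule conjI[rotated], assumption, simp add: rules_def))
  show "sorted_wrt (\<lambda>(l, r) (l', r'). \<not> exp_le l l' \<and> \<not> exp_le l' l) (rules q)"
    using pos less by (simp add: rules_def)
qed (use n in auto)

end

theorem theorem2p11:
  fixes n\<^sub>1 n\<^sub>2 n\<^sub>3 n\<^sub>4 :: nat
    and a\<^sub>1 a\<^sub>2 a\<^sub>3 a\<^sub>4 a\<^sub>1\<^sub>3 a\<^sub>1\<^sub>4 a\<^sub>2\<^sub>1 a\<^sub>2\<^sub>3 a\<^sub>3\<^sub>2 a\<^sub>3\<^sub>4 a\<^sub>4\<^sub>1 a\<^sub>4\<^sub>2 :: nat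
    and I :: "'k::field poly4 set"
  assumes "I = curve_ideal n\<^sub>1 n\<^sub>2 n\<^sub>3 n\<^sub>4"
    and "0 < n\<^sub>1" "n\<^sub>1 < n\<^sub>2" "n\<^sub>2 < n\<^sub>3" "n\<^sub>3 < n\<^sub>4"
    and "Gcd {n\<^sub>1, n\<^sub>2, n\<^sub>3, n\<^sub>4} = 1"
    and "gorenstein_curve n\<^sub>1 n\<^sub>2 n\<^sub>3 n\<^sub>4"
    and "\<not> complete_intersection_ideal I"
    and "cohen_macaulay_tangent_cone I"
    and "minimally_generated_by poly4_ring I
           [X\<^sub>1^a\<^sub>1 - X\<^sub>3^a\<^sub>1\<^sub>3 * X\<^sub>4^a\<^sub>1\<^sub>4,
            X\<^sub>2^a\<^sub>2 - X\<^sub>1^a\<^sub>2\<^sub>1 * X\<^sub>3^a\<^sub>2\<^sub>3,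
            X\<^sub>3^a\<^sub>3 - X\<^sub>2^a\<^sub>3\<^sub>2 * X\<^sub>4^a\<^sub>3\<^sub>4,
            X\<^sub>4^a\<^sub>4 - X\<^sub>1^a\<^sub>4\<^sub>1 * X\<^sub>2^a\<^sub>4\<^sub>2,
            X\<^sub>1^a\<^sub>2\<^sub>1 * X\<^sub>4^a\<^sub>3\<^sub>4 - X\<^sub>2^a\<^sub>4\<^sub>2 * X\<^sub>3^a\<^sub>1\<^sub>3]"
    and "1 < a\<^sub>1" "1 < a\<^sub>2" "1 < a\<^sub>3" "1 < a\<^sub>4"
    and "0 < a\<^sub>2\<^sub>1" "a\<^sub>2\<^sub>1 < a\<^sub>1" "0 < a\<^sub>4\<^sub>1" "a\<^sub>4\<^sub>1 < a\<^sub>1"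
    and "0 < a\<^sub>3\<^sub>2" "a\<^sub>3\<^sub>2 < a\<^sub>2" "0 < a\<^sub>4\<^sub>2" "a\<^sub>4\<^sub>2 < a\<^sub>2"
    and "0 < a\<^sub>1\<^sub>3" "a\<^sub>1\<^sub>3 < a\<^sub>3" "0 < a\<^sub>2\<^sub>3" "a\<^sub>2\<^sub>3 < a\<^sub>3"
    and "0 < a\<^sub>1\<^sub>4" "a\<^sub>1\<^sub>4 < a\<^sub>4" "0 < a\<^sub>3\<^sub>4" "a\<^sub>3\<^sub>4 < a\<^sub>4"
    and "a\<^sub>3 > a\<^sub>3\<^sub>2 + a\<^sub>3\<^sub>4"
    and "a\<^sub>4\<^sub>2 \<le> a\<^sub>3\<^sub>2"
  shows
    "let p\<^sub>2 = (if a\<^sub>2 < a\<^sub>2\<^sub>1 + a\<^sub>2\<^sub>3 then X\<^sub>2^a\<^sub>2 else X\<^sub>2^a\<^sub>2 - X\<^sub>1^a\<^sub>2\<^sub>1 * X\<^sub>3^a\<^sub>2\<^sub>3);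
         p\<^sub>5 = (if a\<^sub>4\<^sub>2 + a\<^sub>1\<^sub>3 < a\<^sub>2\<^sub>1 + a\<^sub>3\<^sub>4 then X\<^sub>2^a\<^sub>4\<^sub>2 * X\<^sub>3^a\<^sub>1\<^sub>3
               else X\<^sub>1^a\<^sub>2\<^sub>1 * X\<^sub>4^a\<^sub>3\<^sub>4 - X\<^sub>2^a\<^sub>4\<^sub>2 * X\<^sub>3^a\<^sub>1\<^sub>3)
     in
      (a\<^sub>3\<^sub>4 < a\<^sub>1\<^sub>4 \<and>
       a\<^sub>2 \<le> a\<^sub>2\<^sub>1 + a\<^sub>2\<^sub>3 \<and>
       a\<^sub>4\<^sub>2 + a\<^sub>1\<^sub>3 \<le> a\<^sub>2\<^sub>1 + a\<^sub>3\<^sub>4 \<and>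
       a\<^sub>3 + a\<^sub>1\<^sub>3 \<le> a\<^sub>2\<^sub>1 + (a\<^sub>3\<^sub>2 - a\<^sub>4\<^sub>2) + 2 * a\<^sub>3\<^sub>4 \<longrightarrow>
       (let p\<^sub>6 = (if a\<^sub>3 + a\<^sub>1\<^sub>3 < a\<^sub>2\<^sub>1 + (a\<^sub>3\<^sub>2 - a\<^sub>4\<^sub>2) + 2 * a\<^sub>3\<^sub>4 then X\<^sub>3^(a\<^sub>3 + a\<^sub>1\<^sub>3)
                  else X\<^sub>3^(a\<^sub>3 + a\<^sub>1\<^sub>3) - X\<^sub>1^a\<^sub>2\<^sub>1 * X\<^sub>2^(a\<^sub>3\<^sub>2 - a\<^sub>4\<^sub>2) * X\<^sub>4^(2 * a\<^sub>3\<^sub>4))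
        in minimally_generated_by poly4_ring (initial_ideal I)
             [X\<^sub>3^a\<^sub>1\<^sub>3 * X\<^sub>4^a\<^sub>1\<^sub>4, p\<^sub>2, X\<^sub>2^a\<^sub>3\<^sub>2 * X\<^sub>4^a\<^sub>3\<^sub>4, X\<^sub>4^a\<^sub>4, p\<^sub>5, p\<^sub>6]))
      \<and>
      (a\<^sub>1\<^sub>4 \<le> a\<^sub>3\<^sub>4 \<and>
       a\<^sub>2 \<le> a\<^sub>2\<^sub>1 + a\<^sub>2\<^sub>3 \<and>
       a\<^sub>4\<^sub>2 + a\<^sub>1\<^sub>3 \<le> a\<^sub>2\<^sub>1 + a\<^sub>3\<^sub>4 \<and>
       a\<^sub>3 + a\<^sub>1\<^sub>3 \<le> a\<^sub>1 + a\<^sub>3\<^sub>2 + (a\<^sub>3\<^sub>4 - a\<^sub>1\<^sub>4) \<longrightarrow>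
       (let p\<^sub>6 = (if a\<^sub>3 + a\<^sub>1\<^sub>3 < a\<^sub>1 + a\<^sub>3\<^sub>2 + (a\<^sub>3\<^sub>4 - a\<^sub>1\<^sub>4) then X\<^sub>3^(a\<^sub>3 + a\<^sub>1\<^sub>3)
                  else X\<^sub>3^(a\<^sub>3 + a\<^sub>1\<^sub>3) - X\<^sub>1^a\<^sub>1 * X\<^sub>2^a\<^sub>3\<^sub>2 * X\<^sub>4^(a\<^sub>3\<^sub>4 - a\<^sub>1\<^sub>4))
        in minimally_generated_by poly4_ring (initial_ideal I)
             [X\<^sub>3^a\<^sub>1\<^sub>3 * X\<^sub>4^a\<^sub>1\<^sub>4, p\<^sub>2, X\<^sub>2^a\<^sub>3\<^sub>2 * X\<^sub>4^a\<^sub>3\<^sub>4, X\<^sub>4^a\<^sub>4, p\<^sub>5, p\<^sub>6]))"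
proof -
  \<comment> \<open>Rewrites products of powers of the variables as single monomials indexed by
    exponent vectors.\<close>
  note monomials = X_powers mult_single
  have gen: "I = Idl\<^bsub>poly4_ring\<^esub>
          {monomial (a\<^sub>1, 0, 0, 0) - monomial (0, 0, a\<^sub>1\<^sub>3, a\<^sub>1\<^sub>4),
           monomial (0, a\<^sub>2, 0, 0) - monomial (a\<^sub>2\<^sub>1, 0, a\<^sub>2\<^sub>3, 0),
           monomial (0, 0, a\<^sub>3, 0) - monomial (0, a\<^sub>3\<^sub>2, 0, a\<^sub>3\<^sub>4),
           monomial (0, 0, 0, a\<^sub>4) - monomial (a\<^sub>4\<^sub>1, a\<^sub>4\<^sub>2, 0, 0),
           monomial (a\<^sub>2\<^sub>1, 0, 0, a\<^sub>3\<^sub>4) - monomial (0, a\<^sub>4\<^sub>2, a\<^sub>1\<^sub>3, 0)}"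
    using assms(10) by (simp add: minimally_generated_by_def monomials)
  interpret bresinsky_curve n\<^sub>1 n\<^sub>2 n\<^sub>3 n\<^sub>4 a\<^sub>1 a\<^sub>2 a\<^sub>3 a\<^sub>4 a\<^sub>1\<^sub>3 a\<^sub>1\<^sub>4 a\<^sub>2\<^sub>1 a\<^sub>2\<^sub>3 a\<^sub>3\<^sub>2 a\<^sub>3\<^sub>4 a\<^sub>4\<^sub>1 a\<^sub>4\<^sub>2 I
    by (rule bresinsky_curve.intro) (fact assms gen)+
  show ?thesis
    unfolding Let_def
  proof (intro conjI impI; elim conjE)
    assume *: "a\<^sub>3\<^sub>4 < a\<^sub>1\<^sub>4" "a\<^sub>2 \<le> a\<^sub>2\<^sub>1 + a\<^sub>2\<^sub>3" "a\<^sub>4\<^sub>2 + a\<^sub>1\<^sub>3 \<le> a\<^sub>2\<^sub>1 + a\<^sub>3\<^sub>4"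
      "a\<^sub>3 + a\<^sub>1\<^sub>3 \<le> a\<^sub>2\<^sub>1 + (a\<^sub>3\<^sub>2 - a\<^sub>4\<^sub>2) + 2 * a\<^sub>3\<^sub>4"
    show "minimally_generated_by poly4_ring (initial_ideal I)
        [X\<^sub>3^a\<^sub>1\<^sub>3 * X\<^sub>4^a\<^sub>1\<^sub>4,
         if a\<^sub>2 < a\<^sub>2\<^sub>1 + a\<^sub>2\<^sub>3 then X\<^sub>2^a\<^sub>2 else X\<^sub>2^a\<^sub>2 - X\<^sub>1^a\<^sub>2\<^sub>1 * X\<^sub>3^a\<^sub>2\<^sub>3,
         X\<^sub>2^a\<^sub>3\<^sub>2 * X\<^sub>4^a\<^sub>3\<^sub>4, X\<^sub>4^a\<^sub>4,
         if a\<^sub>4\<^sub>2 + a\<^sub>1\<^sub>3 < a\<^sub>2\<^sub>1 + a\<^sub>3\<^sub>4 then X\<^sub>2^a\<^sub>4\<^sub>2 * X\<^sub>3^a\<^sub>1\<^sub>3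
         else X\<^sub>1^a\<^sub>2\<^sub>1 * X\<^sub>4^a\<^sub>3\<^sub>4 - X\<^sub>2^a\<^sub>4\<^sub>2 * X\<^sub>3^a\<^sub>1\<^sub>3,
         if a\<^sub>3 + a\<^sub>1\<^sub>3 < a\<^sub>2\<^sub>1 + (a\<^sub>3\<^sub>2 - a\<^sub>4\<^sub>2) + 2 * a\<^sub>3\<^sub>4 then X\<^sub>3^(a\<^sub>3 + a\<^sub>1\<^sub>3)
         else X\<^sub>3^(a\<^sub>3 + a\<^sub>1\<^sub>3) - X\<^sub>1^a\<^sub>2\<^sub>1 * X\<^sub>2^(a\<^sub>3\<^sub>2 - a\<^sub>4\<^sub>2) * X\<^sub>4^(2 * a\<^sub>3\<^sub>4)]"
      \<comment> \<open>The strict degree inequalities reduce the first, third and fourth forms to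
        monomials. In the case of equal degrees \<open>p\<^sub>5\<close> is the negative of the form
        given by its rule.\<close>
      by (rule initial_ideal_generators[where q = "(a\<^sub>2\<^sub>1, a\<^sub>3\<^sub>2 - a\<^sub>4\<^sub>2, 0, 2 * a\<^sub>3\<^sub>4)"])
        (use * assms(31) degree_f1 degree_f4 in \<open>simp_all add: rules_def monomials\<close>)
  next
    assume *: "a\<^sub>1\<^sub>4 \<le> a\<^sub>3\<^sub>4" "a\<^sub>2 \<le> a\<^sub>2\<^sub>1 + a\<^sub>2\<^sub>3" "a\<^sub>4\<^sub>2 + a\<^sub>1\<^sub>3 \<le> a\<^sub>2\<^sub>1 + a\<^sub>3\<^sub>4"
      "a\<^sub>3 + a\<^sub>1\<^sub>3 \<le> a\<^sub>1 + a\<^sub>3\<^sub>2 + (a\<^sub>3\<^sub>4 - a\<^sub>1\<^sub>4)"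
    show "minimally_generated_by poly4_ring (initial_ideal I)
        [X\<^sub>3^a\<^sub>1\<^sub>3 * X\<^sub>4^a\<^sub>1\<^sub>4,
         if a\<^sub>2 < a\<^sub>2\<^sub>1 + a\<^sub>2\<^sub>3 then X\<^sub>2^a\<^sub>2 else X\<^sub>2^a\<^sub>2 - X\<^sub>1^a\<^sub>2\<^sub>1 * X\<^sub>3^a\<^sub>2\<^sub>3,
         X\<^sub>2^a\<^sub>3\<^sub>2 * X\<^sub>4^a\<^sub>3\<^sub>4, X\<^sub>4^a\<^sub>4,
         if a\<^sub>4\<^sub>2 + a\<^sub>1\<^sub>3 < a\<^sub>2\<^sub>1 + a\<^sub>3\<^sub>4 then X\<^sub>2^a\<^sub>4\<^sub>2 * X\<^sub>3^a\<^sub>1\<^sub>3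
         else X\<^sub>1^a\<^sub>2\<^sub>1 * X\<^sub>4^a\<^sub>3\<^sub>4 - X\<^sub>2^a\<^sub>4\<^sub>2 * X\<^sub>3^a\<^sub>1\<^sub>3,
         if a\<^sub>3 + a\<^sub>1\<^sub>3 < a\<^sub>1 + a\<^sub>3\<^sub>2 + (a\<^sub>3\<^sub>4 - a\<^sub>1\<^sub>4) then X\<^sub>3^(a\<^sub>3 + a\<^sub>1\<^sub>3)
         else X\<^sub>3^(a\<^sub>3 + a\<^sub>1\<^sub>3) - X\<^sub>1^a\<^sub>1 * X\<^sub>2^a\<^sub>3\<^sub>2 * X\<^sub>4^(a\<^sub>3\<^sub>4 - a\<^sub>1\<^sub>4)]"
      by (rule initial_ideal_generators[where q = "(a\<^sub>1, a\<^sub>3\<^sub>2, 0, a\<^sub>3\<^sub>4 - a\<^sub>1\<^sub>4)"])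
        (use * assms(31) degree_f1 degree_f4 in \<open>simp_all add: rules_def monomials\<close>)
  qed
qed

end
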